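(* Let $c(n)=\sum_{0\le r,s,t\le n}\frac{n!}{r!\,s!\,t!\,(n-r-s-t)!}r^{n-r-s-t}s^{n-r-s+1}$ (with $0^0=1$, $1/m!=0$ for negative $m$). Then $$c(n)\sim F(r_n,s_n,t_n)\,\frac{(2\pi)^{3/2}r_ns_n\sqrt{t_n}}{n},\qquad n\to\infty,$$ where $(r_n,s_n,t_n)$ is, for large $n$, the unique solution with $r,s,t>0$, $r+s+t<n$ of the system $$-\log r-\log s+\frac{n-r-s-t}{r}-\psi(r+1)+\psi(n-r-s-t+1)=0,$$ $$-\log r-\log s+\frac{n-r-s+1}{s}-\psi(s+1)+\psi(n-r-s-t+1)=0,$$ $$-\log r-\psi(t+1)+\psi(n-r-s-t+1)=0.$$
   Context: $\psi=\Gamma'/\Gamma$ is the digamma function. For given $n$, $F(r,s,t)=\dfrac{\Gamma(n+1)\,r^{n-r-s-t}\,s^{n-r-s+1}}{\Gamma(r+1)\Gamma(s+1)\Gamma(t+1)\Gamma(n-r-s-t+1)}$ for real $r,s,t\ge0$ with $r+s+t\le n$. *)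

theory Defs
  imports "HOL-Analysis.Analysis" "HOL-Library.Landau_Symbols"
begin

text \<open>
  Summands with \<open>r + s + t > n\<close> carry the factor \<open>1 / (n - r - s - t)! = 0\<close>; the explicit
  conditional avoids truncated subtraction.
\<close>

definition c_sum :: "nat \<Rightarrow> real" where
  "c_sum n = (\<Sum>r=0..n. \<Sum>s=0..n. \<Sum>t=0..n.
     if r + s + t \<le> n
     then fact n / (fact r * fact s * fact t * fact (n - r - s - t))
            * real r ^ (n - r - s - t) * real s ^ (n - r - s + 1)
     else 0)"

text \<open>Real power with \<open>0\<^sup>0 = 1\<close>, whereas \<open>0 powr 0 = 0\<close>.\<close>

definition rpow :: "real \<Rightarrow> real \<Rightarrow> real" where
  "rpow x y = (if x = 0 \<and> y = 0 then 1 else x powr y)"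

definition F_term :: "nat \<Rightarrow> real \<Rightarrow> real \<Rightarrow> real \<Rightarrow> real" where
  "F_term n r s t =
     Gamma (real n + 1) * rpow r (real n - r - s - t) * rpow s (real n - r - s + 1)
     / (Gamma (r + 1) * Gamma (s + 1) * Gamma (t + 1) * Gamma (real n - r - s - t + 1))"

definition critical :: "nat \<Rightarrow> real \<Rightarrow> real \<Rightarrow> real \<Rightarrow> bool" where
  "critical n r s t \<longleftrightarrow>
     r > 0 \<and> s > 0 \<and> t > 0 \<and> r + s + t < real n \<and>
     - ln r - ln s + (real n - r - s - t) / r
       - Digamma (r + 1) + Digamma (real n - r - s - t + 1) = 0 \<and>
     - ln r - ln s + (real n - r - s + 1) / s
       - Digamma (s + 1) + Digamma (real n - r - s - t + 1) = 0 \<and>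
     - ln r - Digamma (t + 1) + Digamma (real n - r - s - t + 1) = 0"

end

theory Submission
  imports Defs "HOL-Real_Asymp.Real_Asymp" "HOL-Probability.Distributions"
begin

text \<open>
  Summing over \<open>t\<close> by the binomial theorem turns \<open>c(n)\<close> into a double sum whose summand
  \<open>n! / (r! s! m!) (1 + r)\<^sup>m s\<^bsup>m + 1\<^esup>\<close>, \<open>m = n - r - s\<close>, is log-concave in the real variables
  \<open>(r, s)\<close>. At \<open>(r\<^sub>n, s\<^sub>n)\<close> its logarithmic gradient is \<open>O(1/r\<^sub>n)\<close>, and after rescaling by
  \<open>r\<^sub>n/\<surd>n\<close> and \<open>s\<^sub>n/\<surd>n\<close> its logarithmic Hessian tends to minus the identity; log-concavity supplies
  the domination, so the rescaled sum tends to the Gaussian integral \<open>2\<pi>\<close>. Finally \<open>F\<close> is that summand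
  times a binomial probability near its mean, which Stirling's formula evaluates as \<open>1 / \<surd>(2\<pi>t\<^sub>n)\<close>.

  The system forces \<open>r < s = o(n)\<close> and \<open>t = O(log n)\<close>, hence all its solutions lie in a half-space on
  which \<open>log F\<close> is strictly concave; this gives uniqueness. Existence follows from Brouwer's theorem
  on a box with \<open>r, s\<close> of order \<open>n / log n\<close> and \<open>t\<close> between \<open>log n / 4\<close> and \<open>(log n)\<^sup>2\<close>.
\<close>

section \<open>The digamma function and Stirling's formula\<close>

lemma not_nonpos_Ints_real_pos: "(x::real) > 0 \<Longrightarrow> x \<notin> \<int>\<^sub>\<le>\<^sub>0"
  by (auto elim!: nonpos_Ints_cases)

lemma ln_Gamma_real_plus1:
  fixes x :: real
  assumes "x > 0"
  shows "ln_Gamma (x + 1) = ln_Gamma x + ln x"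
proof -
  have "Gamma (x + 1) = x * Gamma x"
    by (rule Gamma_plus1) (use assms in auto)
  then show ?thesis
    using assms ln_mult_pos[OF assms Gamma_real_pos[OF assms]] by (simp add: ln_Gamma_real_pos)
qed

lemma
  fixes x :: real
  assumes "x > 0"
  shows Digamma_le_ln: "Digamma x \<le> ln x"
    and ln_le_Digamma_plus1: "ln x \<le> Digamma (x + 1)"
proof -
  have "\<exists>z. z > x \<and> z < x + 1 \<and> ln_Gamma (x + 1) - ln_Gamma x = (x + 1 - x) * Digamma z"
    by (rule MVT2) (use assms in \<open>auto intro!: derivative_eq_intros\<close>)
  then obtain z where "x < z" "z < x + 1" "ln x = Digamma z"
    using ln_Gamma_real_plus1[OF assms] by auto
  then show "Digamma x \<le> ln x" "ln x \<le> Digamma (x + 1)"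
    using assms Digamma_real_mono[of x z] Digamma_real_mono[of z "x + 1"] by auto
qed

lemma Digamma_plus1_ge_minus_1:
  fixes x :: real
  assumes "x \<ge> 0"
  shows "Digamma (x + 1) \<ge> - 1"
proof -
  have "Digamma 1 \<le> Digamma (x + 1)"
    using assms by (intro Digamma_real_mono) auto
  then show ?thesis
    using euler_mascheroni_less_13_over_22 by simp
qed

lemma
  fixes x :: real
  assumes "x > 0"
  shows Polygamma_1_ge: "1 / x \<le> Polygamma 1 x"
    and Polygamma_1_plus1_le: "Polygamma 1 (x + 1) \<le> 1 / x"
proof -
  have "\<exists>z. z > x \<and> z < x + 1 \<and> Digamma (x + 1) - Digamma x = (x + 1 - x) * Polygamma 1 z"
    by (rule MVT2) (use assms in \<open>auto intro!: derivative_eq_intros\<close>)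
  then obtain z where "x < z" "z < x + 1" "1 / x = Polygamma 1 z"
    using Digamma_plus1[of x] assms by auto
  then show "1 / x \<le> Polygamma 1 x" "Polygamma 1 (x + 1) \<le> 1 / x"
    using assms Polygamma_real_strict_antimono[of x z 1]
      Polygamma_real_strict_antimono[of z "x + 1" 1] by auto
qed

lemma Polygamma_1_pos:
  fixes x :: real
  assumes "x > 0"
  shows "Polygamma 1 x > 0"
  using assms by (intro Polygamma_real_odd_pos not_nonpos_Ints_real_pos) auto

lemma ln_Gamma_real_legendre_duplication:
  fixes x :: real
  assumes "x > 0"
  shows "ln_Gamma x + ln_Gamma (x + 1/2) = (1 - 2 * x) * ln 2 + ln pi / 2 + ln_Gamma (2 * x)"
proof -
  have "complex_of_real x \<notin> \<int>\<^sub>\<le>\<^sub>0" "complex_of_real x + 1/2 \<notin> \<int>\<^sub>\<le>\<^sub>0"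
    using assms by (auto elim!: nonpos_Ints_cases simp: complex_eq_iff)
  from Gamma_legendre_duplication[OF this]
  have "complex_of_real (Gamma x * Gamma (x + 1/2)) =
          complex_of_real (exp ((1 - 2 * x) * ln 2) * sqrt pi * Gamma (2 * x))"
    by (simp add: Gamma_complex_of_real [symmetric] exp_of_real [symmetric] mult_ac)
  then have "Gamma x * Gamma (x + 1/2) = exp ((1 - 2 * x) * ln 2) * sqrt pi * Gamma (2 * x)"
    using of_real_eq_iff by blast
  then have "ln (Gamma x * Gamma (x + 1/2)) = ln (exp ((1 - 2 * x) * ln 2) * sqrt pi * Gamma (2 * x))"
    by simp
  moreover have "Gamma x > 0" "Gamma (x + 1/2) > 0" "Gamma (2 * x) > 0"
    using assms by (auto intro!: Gamma_real_pos)
  ultimately show ?thesis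
    using assms by (simp add: ln_mult ln_Gamma_real_pos ln_sqrt)
qed

definition stirling_error :: "real \<Rightarrow> real" where
  "stirling_error x = ln_Gamma (x + 1) - ((x + 1/2) * ln x - x)"

lemma ln_Gamma_plus1_eq_stirling: "ln_Gamma (x + 1) = (x + 1/2) * ln x - x + stirling_error x"
  by (simp add: stirling_error_def)

lemma has_real_derivative_stirling_error:
  assumes "x > 0"
  shows "(stirling_error has_real_derivative (Digamma (x + 1) - ln x - 1 / (2 * x))) (at x)"
  unfolding stirling_error_def
  by (rule derivative_eq_intros refl | use assms in \<open>simp add: field_simps\<close>)+

lemma abs_deriv_stirling_error_le:
  fixes x :: real
  assumes "x > 0"
  shows "\<bar>Digamma (x + 1) - ln x - 1 / (2 * x)\<bar> \<le> 1 / x"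
proof -
  have "Digamma (x + 1) \<le> ln (x + 1)" "ln x \<le> Digamma (x + 1)"
    using assms by (auto intro!: Digamma_le_ln ln_le_Digamma_plus1)
  moreover have "ln (x + 1) - ln x \<le> 1 / x"
    using ln_diff_le[of "x + 1" x] assms by simp
  ultimately show ?thesis
    using assms by (simp add: abs_le_iff)
qed

lemma abs_stirling_error_diff_le:
  assumes "0 < a" "a \<le> x"
  shows "\<bar>stirling_error x - stirling_error a\<bar> \<le> (x - a) / a"
proof (cases "a = x")
  case False
  then have "\<exists>z. z > a \<and> z < x \<and> stirling_error x - stirling_error a =
      (x - a) * (Digamma (z + 1) - ln z - 1 / (2 * z))"
    by (intro MVT2 has_real_derivative_stirling_error) (use assms in auto)
  then obtain z where a_less_z: "a < z" and mvt: "stirling_error x - stirling_error a =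
      (x - a) * (Digamma (z + 1) - ln z - 1 / (2 * z))" by auto
  have "\<bar>Digamma (z + 1) - ln z - 1 / (2 * z)\<bar> \<le> 1 / z"
    using a_less_z assms by (intro abs_deriv_stirling_error_le) auto
  also have "\<dots> \<le> 1 / a"
    using a_less_z assms by (simp add: field_simps)
  finally have "(x - a) * \<bar>Digamma (z + 1) - ln z - 1 / (2 * z)\<bar> \<le> (x - a) * (1 / a)"
    using assms by (intro mult_left_mono) auto
  then show ?thesis
    using assms mvt by (simp add: abs_mult)
qed (use assms in auto)

lemma convergent_stirling_error_nat: "convergent (\<lambda>n. stirling_error (real n))"
proof -
  have "(\<lambda>n. stirling_error (real (Suc n)) - stirling_error (real n)) \<in>
          O(\<lambda>n::nat. 1 - (real n + 1/2) * ln (1 + 1 / real n))"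
  proof (rule bigoI[where c = 1], use eventually_gt_at_top[of "0::nat"] in eventually_elim)
    case (elim n)
    have "ln (1 + real n) = ln (real n) + ln (1 + 1 / real n)"
      using elim ln_div[of "1 + real n" "real n"] by (simp add: field_simps)
    then show ?case
      using ln_Gamma_real_plus1[of "real n + 1"] elim
      by (simp add: stirling_error_def algebra_simps)
  qed
  also have "(\<lambda>n::nat. 1 - (real n + 1/2) * ln (1 + 1 / real n)) \<in> O(\<lambda>n. real n powr (-2))"
    by real_asymp
  finally have "summable (\<lambda>n. stirling_error (real (Suc n)) - stirling_error (real n))"
    by (rule summable_comparison_test_bigo[rotated]) (simp add: summable_real_powr_iff)
  then have "convergent (\<lambda>n. \<Sum>k<n. stirling_error (real (Suc k)) - stirling_error (real k))"
    by (simp add: summable_iff_convergent)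
  then have "convergent (\<lambda>n. stirling_error (real n) - stirling_error (real 0))"
    using sum_lessThan_telescope[of "\<lambda>n. stirling_error (real n)"] by simp
  then show ?thesis
    by (simp only: convergent_diff_const_right_iff)
qed

lemma tendsto_at_top_if_tendsto_nat:
  fixes f :: "real \<Rightarrow> 'a :: real_normed_vector"
  assumes nat: "(\<lambda>n. f (real n)) \<longlonglongrightarrow> c"
    and gap: "((\<lambda>x. f x - f (real (nat \<lfloor>x\<rfloor>))) \<longlongrightarrow> 0) at_top"
  shows "(f \<longlongrightarrow> c) at_top"
proof -
  have "filterlim (\<lambda>x::real. nat \<lfloor>x\<rfloor>) at_top at_top"
    by (rule filterlim_compose[OF filterlim_nat_sequentially filterlim_floor_sequentially])
  then have "((\<lambda>x::real. f (real (nat \<lfloor>x\<rfloor>))) \<longlongrightarrow> c) at_top"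
    by (rule filterlim_compose[OF nat])
  from tendsto_add[OF this gap] show ?thesis by simp
qed

lemma convergent_stirling_error: "\<exists>c. (stirling_error \<longlongrightarrow> c) at_top"
proof -
  obtain c where "(\<lambda>n. stirling_error (real n)) \<longlonglongrightarrow> c"
    using convergent_stirling_error_nat by (auto simp: convergent_def)
  moreover have "((\<lambda>x. stirling_error x - stirling_error (real (nat \<lfloor>x\<rfloor>))) \<longlongrightarrow> 0) at_top"
  proof (rule Lim_null_comparison)
    show "((\<lambda>x::real. 1 / (x - 1)) \<longlongrightarrow> 0) at_top" by real_asymp
    show "\<forall>\<^sub>F x in at_top. norm (stirling_error x - stirling_error (real (nat \<lfloor>x\<rfloor>))) \<le> 1 / (x - 1)"
      using eventually_gt_at_top[of 1]
    proof eventually_elim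
      case (elim x)
      define k where "k = real (nat \<lfloor>x\<rfloor>)"
      have k_bounds: "0 < k" "k \<le> x" "x < k + 1"
        using elim by (auto simp: k_def floor_correct)
      have "\<bar>stirling_error x - stirling_error k\<bar> \<le> (x - k) / k"
        using k_bounds by (intro abs_stirling_error_diff_le)
      also have "\<dots> \<le> 1 / (x - 1)"
        using k_bounds elim by (intro frac_le) auto
      finally show ?case by (simp add: k_def)
    qed
  qed
  ultimately show ?thesis
    by (blast intro: tendsto_at_top_if_tendsto_nat)
qed

lemma stirling_error_duplication:
  assumes "x > 1/2"
  shows "stirling_error (2 * x) - stirling_error (x - 1/2) - stirling_error x =
           x * (ln (x - 1/2) - ln x) + 1/2 - ln (2 * pi) / 2"
proof -
  have "ln (2 * x) = ln 2 + ln x" "ln (2 * pi) = ln 2 + ln pi"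
    using assms by (simp_all add: ln_mult)
  then show ?thesis
    using ln_Gamma_real_legendre_duplication[of "x + 1/2"] assms
    by (simp add: stirling_error_def algebra_simps add_divide_distrib)
qed

theorem stirling_error_tendsto: "(stirling_error \<longlongrightarrow> ln (2 * pi) / 2) at_top"
proof -
  obtain c where stirling_tendsto_c: "(stirling_error \<longlongrightarrow> c) at_top"
    using convergent_stirling_error by blast
  have "((\<lambda>x. stirling_error (2 * x)) \<longlongrightarrow> c) at_top" "((\<lambda>x. stirling_error (x - 1/2)) \<longlongrightarrow> c) at_top"
    by (rule filterlim_compose[OF stirling_tendsto_c], real_asymp)+
  then have "((\<lambda>x. stirling_error (2 * x) - stirling_error (x - 1/2) - stirling_error x)
      \<longlongrightarrow> c - c - c) at_top"
    by (intro tendsto_diff stirling_tendsto_c)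
  moreover have "\<forall>\<^sub>F x in at_top. stirling_error (2 * x) - stirling_error (x - 1/2) - stirling_error x =
      x * (ln (x - 1/2) - ln x) + 1/2 - ln (2 * pi) / 2"
    using eventually_gt_at_top[of "1/2"] by eventually_elim (rule stirling_error_duplication)
  ultimately have "((\<lambda>x. x * (ln (x - 1/2) - ln x) + 1/2 - ln (2 * pi) / 2) \<longlongrightarrow> c - c - c) at_top"
    by (rule Lim_transform_eventually)
  moreover have "((\<lambda>x::real. x * (ln (x - 1/2) - ln x)) \<longlongrightarrow> - 1/2) at_top"
    by real_asymp
  then have "((\<lambda>x::real. x * (ln (x - 1/2) - ln x) + 1/2 - ln (2 * pi) / 2) \<longlongrightarrow>
      - 1/2 + 1/2 - ln (2 * pi) / 2) at_top"
    by (intro tendsto_intros)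
  ultimately have "c - c - c = - 1/2 + 1/2 - ln (2 * pi) / 2"
    by (rule tendsto_unique[rotated]) simp
  then have "c = ln (2 * pi) / 2" by simp
  with stirling_tendsto_c show ?thesis by simp
qed

section \<open>The binomial distribution near its mean\<close>

lemma
  fixes p q :: real
  assumes "p > 0" "q > 0"
  shows mult_ln_divide_ge: "p - q \<le> p * ln (p / q)"
    and mult_ln_divide_le: "p * ln (p / q) \<le> p - q + (p - q)\<^sup>2 / q"
proof -
  have "p * ln (q / p) \<le> p * (q / p - 1)" "p * ln (p / q) \<le> p * (p / q - 1)"
    using assms by (intro mult_left_mono ln_le_minus_one; simp)+
  moreover have "p * ln (q / p) = - (p * ln (p / q))" "p * (q / p - 1) = q - p"
    using assms by (simp_all add: ln_div algebra_simps)
  moreover have "p * (p / q - 1) = p - q + (p - q)\<^sup>2 / q"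
    using assms by (simp add: field_simps power2_eq_square)
  ultimately show "p - q \<le> p * ln (p / q)" "p * ln (p / q) \<le> p - q + (p - q)\<^sup>2 / q"
    by linarith+
qed

text \<open>
  For natural \<open>t\<close> and \<open>u\<close>, the probability of \<open>t\<close> successes in \<open>t + u\<close> Bernoulli trials
  with success probability \<open>1 / (1 + r)\<close>.
\<close>

definition binomial_density :: "real \<Rightarrow> real \<Rightarrow> real \<Rightarrow> real" where
  "binomial_density t u r =
     Gamma (t + u + 1) / (Gamma (t + 1) * Gamma (u + 1)) * r powr u / (1 + r) powr (t + u)"

definition binomial_entropy :: "real \<Rightarrow> real \<Rightarrow> real \<Rightarrow> real" where
  "binomial_entropy t u r =
     t * ln (t / ((t + u) / (1 + r))) + u * ln (u / ((t + u) * r / (1 + r)))"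

lemma binomial_density_eq_exp:
  assumes "t > 0" "u > 0" "r > 0"
  shows "binomial_density t u r * sqrt (t * u / (t + u)) =
           exp (stirling_error (t + u) - stirling_error t - stirling_error u - binomial_entropy t u r)"
proof -
  have Gamma: "Gamma (x + 1) = exp (ln_Gamma (x + 1))" if "x > 0" for x :: real
    using that by (intro Gamma_real_pos_exp) simp
  have sqrt: "sqrt (t * u / (t + u)) = exp ((ln t + ln u - ln (t + u)) / 2)"
  proof -
    have "sqrt y = exp (ln y / 2)" if "y > 0" for y :: real
      using that by (simp flip: ln_sqrt)
    then show ?thesis
      using assms by (simp add: ln_mult ln_div)
  qed
  have powr: "r powr u = exp (u * ln r)" "(1 + r) powr (t + u) = exp ((t + u) * ln (1 + r))"
    using assms by (simp_all add: powr_def)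
  have "binomial_density t u r * sqrt (t * u / (t + u)) =
     exp (ln_Gamma (t + u + 1) - (ln_Gamma (t + 1) + ln_Gamma (u + 1))
      + u * ln r - (t + u) * ln (1 + r) + (ln t + ln u - ln (t + u)) / 2)"
    unfolding binomial_density_def sqrt powr exp_add exp_diff using assms by (simp add: Gamma)
  also have "ln_Gamma (t + u + 1) - (ln_Gamma (t + 1) + ln_Gamma (u + 1))
      + u * ln r - (t + u) * ln (1 + r) + (ln t + ln u - ln (t + u)) / 2 =
     stirling_error (t + u) - stirling_error t - stirling_error u - binomial_entropy t u r"
  proof -
    have ln_ratio: "ln (t / ((t + u) / (1 + r))) = ln t + ln (1 + r) - ln (t + u)"
      "ln (u / ((t + u) * r / (1 + r))) = ln u + ln (1 + r) - ln (t + u) - ln r"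
      using assms by (simp_all add: ln_mult ln_div)
    show ?thesis
      unfolding binomial_entropy_def ln_ratio ln_Gamma_plus1_eq_stirling by (simp add: field_simps)
  qed
  finally show ?thesis .
qed

lemma
  assumes "t > 0" "u > 0" "r > 0"
  shows binomial_entropy_nonneg: "0 \<le> binomial_entropy t u r"
    and binomial_entropy_le: "binomial_entropy t u r \<le> (t * r - u)\<^sup>2 / ((t + u) * r)"
proof -
  define a b d where "a = (t + u) / (1 + r)" and "b = (t + u) * r / (1 + r)" and "d = t * r - u"
  have pos: "a > 0" "b > 0"
    using assms by (auto simp: a_def b_def)
  have t_deviation: "t - a = d / (1 + r)" and u_deviation: "u - b = - d / (1 + r)"
    using assms by (auto simp: a_def b_def d_def field_simps)
  note ln_bounds = mult_ln_divide_ge mult_ln_divide_le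
  have entropy_nonneg: "0 \<le> binomial_entropy t u r"
    and entropy_le: "binomial_entropy t u r \<le> (t - a)\<^sup>2 / a + (u - b)\<^sup>2 / b"
    using ln_bounds[of t a] ln_bounds[of u b] assms pos t_deviation u_deviation
    by (simp_all add: binomial_entropy_def a_def b_def)
  show "0 \<le> binomial_entropy t u r" by (fact entropy_nonneg)
  have chi_square: "(d / (1 + r))\<^sup>2 / (m / (1 + r)) + (- d / (1 + r))\<^sup>2 / (m * r / (1 + r)) =
      d\<^sup>2 / (m * r)"
    if "m > 0" for m
    using that assms by (simp add: divide_simps) (simp add: power2_eq_square algebra_simps)
  show "binomial_entropy t u r \<le> (t * r - u)\<^sup>2 / ((t + u) * r)"
    using entropy_le chi_square[of "t + u"] assms unfolding t_deviation u_deviation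
    by (simp add: a_def b_def d_def)
qed

theorem binomial_density_tendsto:
  fixes t u r :: "'a \<Rightarrow> real"
  assumes t_at_top: "filterlim t at_top F" and u_at_top: "filterlim u at_top F"
    and r_pos: "\<forall>\<^sub>F x in F. r x > 0"
    and mean: "((\<lambda>x. (t x * r x - u x)\<^sup>2 / ((t x + u x) * r x)) \<longlongrightarrow> 0) F"
  shows "((\<lambda>x. binomial_density (t x) (u x) (r x) * sqrt (t x * u x / (t x + u x)))
            \<longlongrightarrow> 1 / sqrt (2 * pi)) F"
proof -
  have pos: "\<forall>\<^sub>F x in F. t x > 0 \<and> u x > 0 \<and> r x > 0"
    using filterlim_at_top_dense[THEN iffD1, OF t_at_top, rule_format, of 0]
      filterlim_at_top_dense[THEN iffD1, OF u_at_top, rule_format, of 0] r_pos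
    by eventually_elim simp
  have "((\<lambda>x. binomial_entropy (t x) (u x) (r x)) \<longlongrightarrow> 0) F"
  proof (rule Lim_null_comparison[OF _ mean], use pos in eventually_elim)
    case (elim x)
    then show ?case
      using binomial_entropy_nonneg[of "t x" "u x" "r x"] binomial_entropy_le[of "t x" "u x" "r x"]
      by simp
  qed
  moreover note filterlim_compose[OF stirling_error_tendsto filterlim_at_top_add_at_top[OF t_at_top u_at_top]]
    filterlim_compose[OF stirling_error_tendsto t_at_top]
    filterlim_compose[OF stirling_error_tendsto u_at_top]
  ultimately have "((\<lambda>x. exp (stirling_error (t x + u x) - stirling_error (t x) - stirling_error (u x)
      - binomial_entropy (t x) (u x) (r x))) \<longlongrightarrow>
      exp (ln (2 * pi) / 2 - ln (2 * pi) / 2 - ln (2 * pi) / 2 - 0)) F"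
    by (intro tendsto_exp tendsto_diff)
  moreover have "exp (ln (2 * pi) / 2 - ln (2 * pi) / 2 - ln (2 * pi) / 2 - 0) = 1 / sqrt (2 * pi)"
    by (simp add: ln_sqrt [symmetric] exp_minus field_simps)
  ultimately show ?thesis
    by (auto elim!: Lim_transform_eventually intro: eventually_mono[OF pos] simp: binomial_density_eq_exp)
qed

section \<open>Laplace's method for lattice sums in the plane\<close>

lemma concave_on_compose_affine:
  fixes T :: "'a::real_vector \<Rightarrow> 'b::real_vector"
  assumes "concave_on S f" "linear T"
  shows "concave_on {x. c + T x \<in> S} (\<lambda>x. f (c + T x))"
proof -
  interpret T: linear T by fact
  have affine: "c + T (u *\<^sub>R x + v *\<^sub>R y) = u *\<^sub>R (c + T x) + v *\<^sub>R (c + T y)" if "u + v = 1"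
    for u v x y
  proof -
    have "u *\<^sub>R (c + T x) + v *\<^sub>R (c + T y) = (u + v) *\<^sub>R c + T (u *\<^sub>R x + v *\<^sub>R y)"
      by (simp add: T.add T.scale algebra_simps)
    then show ?thesis
      using that by simp
  qed
  show ?thesis
    using assms(1) unfolding concave_on_iff convex_def by (simp add: affine)
qed

lemma concave_on_linear_decay:
  fixes f :: "'a::real_normed_vector \<Rightarrow> real"
  assumes concave: "concave_on D f" and zero: "0 \<in> D" "0 \<le> f 0"
    and ball: "\<And>x. norm x \<le> 1 \<Longrightarrow> f x \<le> c"
    and sphere: "\<And>x. norm x = 1 \<Longrightarrow> f x \<le> - c"
    and x_in_D: "x \<in> D"
  shows "f x \<le> 2 * c - c * norm x"
proof -
  have c_nonneg: "0 \<le> c"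
    using ball[of 0] zero by simp
  show ?thesis
  proof (cases "norm x \<le> 1")
    case True
    then have "c * norm x \<le> c * 1"
      using c_nonneg by (intro mult_left_mono)
    then show ?thesis
      using ball[OF True] by simp
  next
    case False
    define l where "l = 1 / norm x"
    have l_bounds: "0 < l" "l \<le> 1" "l * norm x = 1"
      using False by (auto simp: l_def divide_le_eq)
    have "(1 - l) * f 0 + l * f x \<le> f ((1 - l) *\<^sub>R 0 + l *\<^sub>R x)"
      using l_bounds x_in_D zero by (intro concave_onD[OF concave]) auto
    also have "\<dots> \<le> - c"
      using l_bounds by (intro sphere) simp
    finally have "l * f x \<le> - c"
      using l_bounds zero mult_nonneg_nonneg[of "1 - l" "f 0"] by linarith
    also have "- c = l * (- c * norm x)"
      using l_bounds by (simp add: mult.left_commute)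
    finally have "f x \<le> - c * norm x"
      using l_bounds(1) by (simp only: mult_le_cancel_left_pos)
    then show ?thesis
      using c_nonneg by simp
  qed
qed

lemma tendsto_uniform_limit_compose:
  fixes g :: "'a::t2_space \<Rightarrow> 'b::real_normed_vector"
  assumes unif: "uniform_limit S f g F" and z_tendsto: "(z \<longlongrightarrow> p) F" "\<forall>\<^sub>F n in F. z n \<in> S"
    and cont: "isCont g p"
  shows "((\<lambda>n. f n (z n)) \<longlongrightarrow> g p) F"
proof (rule Lim_transform)
  show "((\<lambda>n. g (z n)) \<longlongrightarrow> g p) F"
    by (rule isCont_tendsto_compose[OF cont z_tendsto(1)])
  show "((\<lambda>n. f n (z n) - g (z n)) \<longlongrightarrow> 0) F"
  proof (rule tendstoI)
    fix e :: real
    assume "e > 0"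
    show "\<forall>\<^sub>F n in F. dist (f n (z n) - g (z n)) 0 < e"
      using uniform_limitD[OF unif \<open>e > 0\<close>] z_tendsto(2) by eventually_elim (simp add: dist_norm)
  qed
qed

lemma has_bochner_integral_lborel_prod:
  fixes f :: "'a::euclidean_space \<Rightarrow> real \<Rightarrow> real"
  assumes "\<And>b. b \<in> Basis \<Longrightarrow> has_bochner_integral lborel (f b) (I b)"
    and nonneg: "\<And>b x. b \<in> Basis \<Longrightarrow> 0 \<le> f b x"
  shows "has_bochner_integral lborel (\<lambda>x::'a. \<Prod>b\<in>Basis. f b (x \<bullet> b)) (\<Prod>b\<in>Basis. I b)"
proof (rule has_bochner_integral_nn_integral)
  have integral_f: "integrable lborel (f b)" "integral\<^sup>L lborel (f b) = I b" if "b \<in> Basis" for b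
    using assms(1)[OF that] by (auto simp: has_bochner_integral_iff)
  then have [measurable]: "f b \<in> borel_measurable borel" if "b \<in> Basis" for b
    using that borel_measurable_integrable by force
  show "(\<lambda>x. \<Prod>b\<in>Basis. f b (x \<bullet> b)) \<in> borel_measurable lborel"
    by measurable
  have I_nonneg: "0 \<le> I b" if "b \<in> Basis" for b
    using integral_f[OF that] nonneg[OF that] by (metis integral_nonneg_AE AE_I2)
  have "(\<integral>\<^sup>+x. ennreal (\<Prod>b\<in>Basis. f b (x \<bullet> b)) \<partial>lborel) =
      (\<integral>\<^sup>+x. (\<Prod>b\<in>Basis. ennreal (f b (x \<bullet> b))) \<partial>lborel)"
    using nonneg by (simp add: prod_ennreal)
  also have "\<dots> = (\<Prod>b\<in>Basis. \<integral>\<^sup>+x. ennreal (f b x) \<partial>lborel)"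
    by (rule nn_integral_lborel_prod) auto
  also have "\<dots> = (\<Prod>b\<in>Basis. ennreal (I b))"
    using integral_f nonneg by (intro prod.cong refl) (simp add: nn_integral_eq_integral)
  also have "\<dots> = ennreal (\<Prod>b\<in>Basis. I b)"
    using I_nonneg by (rule prod_ennreal)
  finally show "(\<integral>\<^sup>+x. ennreal (\<Prod>b\<in>Basis. f b (x \<bullet> b)) \<partial>lborel) = ennreal (\<Prod>b\<in>Basis. I b)" .
  show "0 \<le> (\<Prod>b\<in>Basis. I b)"
    using I_nonneg by (rule prod_nonneg)
  show "AE x in lborel. 0 \<le> (\<Prod>b\<in>Basis. f b (x \<bullet> b))"
    using nonneg by (auto intro!: prod_nonneg)
qed

lemma has_bochner_integral_gaussian:
  "has_bochner_integral lborel (\<lambda>x::'a::euclidean_space. exp (- (norm x)\<^sup>2 / 2)) (sqrt (2 * pi) ^ DIM('a))"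
proof -
  have "has_bochner_integral lborel (\<lambda>x. sqrt (2 * pi) * (std_normal_density x * x ^ (2 * 0)))
      (sqrt (2 * pi) * 1)"
    using std_normal_moment_even[of 0] by (intro has_bochner_integral_mult_right) simp
  then have "has_bochner_integral lborel (\<lambda>x::'a. \<Prod>b\<in>Basis. exp (- (x \<bullet> b)\<^sup>2 / 2))
      (\<Prod>b\<in>(Basis::'a set). sqrt (2 * pi))"
    by (intro has_bochner_integral_lborel_prod) (simp_all add: std_normal_density_def)
  moreover have "(\<Prod>b\<in>Basis. exp (- (x \<bullet> b)\<^sup>2 / 2)) = exp (- (norm x)\<^sup>2 / 2)" for x :: 'a
  proof -
    have "(norm x)\<^sup>2 = (\<Sum>b\<in>Basis. (x \<bullet> b)\<^sup>2)"
      unfolding power2_norm_eq_inner by (subst euclidean_inner) (simp add: power2_eq_square)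
    then show ?thesis
      by (simp add: exp_sum [symmetric] sum_negf sum_divide_distrib)
  qed
  ultimately show ?thesis by simp
qed

lemma integrable_exp_minus_abs:
  assumes "c > 0"
  shows "integrable lborel (\<lambda>x::real. exp (- c * \<bar>x\<bar>))"
proof -
  let ?f = "\<lambda>x::real. indicator {0..} x *\<^sub>R exp (- c * x)"
  have "(\<lambda>x::real. exp (- c * x)) absolutely_integrable_on {0..}"
    by (intro nonnegative_absolutely_integrable_1 integrable_on_exp_minus_to_infinity assms) auto
  then have "integrable lebesgue ?f"
    by (simp add: set_integrable_def)
  then have right: "integrable lborel ?f"
    by (subst (asm) integrable_completion) auto
  then have left: "integrable lborel (\<lambda>x. ?f (0 + (- 1) * x))"
    by (rule lborel_integrable_real_affine) simp
  show ?thesis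
    by (rule Bochner_Integration.integrable_bound[OF Bochner_Integration.integrable_add[OF right left]])
      (auto split: split_indicator)
qed

lemma integrable_exp_minus_norm:
  assumes "c > 0"
  shows "integrable lborel (\<lambda>x::'a::euclidean_space. exp (- c * norm x))"
proof (rule Bochner_Integration.integrable_bound)
  let ?d = "c / DIM('a)"
  have "has_bochner_integral lborel (\<lambda>x::real. exp (- ?d * \<bar>x\<bar>))
      (integral\<^sup>L lborel (\<lambda>x. exp (- ?d * \<bar>x\<bar>)))"
    using assms by (intro has_bochner_integral_integrable integrable_exp_minus_abs) simp
  from has_bochner_integral_lborel_prod[where 'a = 'a, OF this]
  show "integrable lborel (\<lambda>x::'a. \<Prod>b\<in>Basis. exp (- ?d * \<bar>x \<bullet> b\<bar>))"
    by (simp add: has_bochner_integral_iff)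
  have "exp (- c * norm x) \<le> (\<Prod>b\<in>Basis. exp (- ?d * \<bar>x \<bullet> b\<bar>))" for x :: 'a
  proof -
    have "(\<Sum>b\<in>Basis. \<bar>x \<bullet> b\<bar>) \<le> DIM('a) * norm x"
      by (rule sum_bounded_above) (rule Basis_le_norm)
    then have "?d * (\<Sum>b\<in>Basis. \<bar>x \<bullet> b\<bar>) \<le> ?d * (DIM('a) * norm x)"
      using assms by (intro mult_left_mono) auto
    then show ?thesis
      by (simp add: exp_sum [symmetric] sum_negf sum_distrib_left)
  qed
  then show "AE x in lborel. norm (exp (- c * norm (x::'a))) \<le> norm (\<Prod>b\<in>Basis. exp (- ?d * \<bar>x \<bullet> b\<bar>))"
    by (simp add: abs_prod)
qed simp

abbreviation scale_pair :: "real \<Rightarrow> real \<Rightarrow> real \<times> real \<Rightarrow> real \<times> real" where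
  "scale_pair a b \<equiv> map_prod ((*) a) ((*) b)"

abbreviation floor_pair :: "real \<times> real \<Rightarrow> int \<times> int" where
  "floor_pair \<equiv> map_prod floor floor"

abbreviation of_int_pair :: "int \<times> int \<Rightarrow> real \<times> real" where
  "of_int_pair \<equiv> map_prod of_int of_int"

lemma linear_scale_pair: "linear (scale_pair a b)"
  by (auto intro!: linearI simp: algebra_simps)

lemma finite_lattice_points:
  assumes "bounded S"
  shows "finite {k. of_int_pair k \<in> S}"
proof -
  obtain M where norm_le_M: "\<And>p. p \<in> S \<Longrightarrow> norm p \<le> M"
    using assms by (auto simp: bounded_iff)
  have "k \<in> {-\<lceil>M\<rceil>..\<lceil>M\<rceil>} \<times> {-\<lceil>M\<rceil>..\<lceil>M\<rceil>}" if "of_int_pair k \<in> S" for k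
  proof (cases k)
    case (Pair i j)
    then have "\<bar>of_int i\<bar> \<le> M" "\<bar>of_int j\<bar> \<le> M"
      using norm_le_M[OF that] norm_fst_le[of "of_int i :: real" "of_int j :: real"]
        norm_snd_le[of "of_int j :: real" "of_int i :: real"] by auto
    then show ?thesis
      using Pair by (simp add: abs_le_iff) linarith
  qed
  then have "{k. of_int_pair k \<in> S} \<subseteq> {-\<lceil>M\<rceil>..\<lceil>M\<rceil>} \<times> {-\<lceil>M\<rceil>..\<lceil>M\<rceil>}"
    by blast
  then show ?thesis
    by (rule finite_subset) simp
qed

lemma floor_affine_vimage:
  fixes a c :: real
  assumes "a > 0"
  shows "{x. \<lfloor>c + a * x\<rfloor> = i} = {(i - c) / a ..< (i - c) / a + 1 / a}"
  using assms by (auto simp: floor_eq_iff field_simps)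

lemma has_bochner_integral_lattice_step:
  fixes g :: "int \<times> int \<Rightarrow> real" and c :: "real \<times> real"
  assumes pos: "a > 0" "b > 0" and "finite I" and support: "\<And>k. k \<notin> I \<Longrightarrow> g k = 0"
  shows "has_bochner_integral lborel (\<lambda>p. g (floor_pair (c + scale_pair a b p))) ((\<Sum>k\<in>I. g k) / (a * b))"
proof -
  define cell where "cell k = {p. floor_pair (c + scale_pair a b p) = k}" for k
  have cell: "cell (i, j) = {(i - fst c) / a ..< (i - fst c) / a + 1 / a} \<times>
      {(j - snd c) / b ..< (j - snd c) / b + 1 / b}" for i j
    using floor_affine_vimage[OF pos(1), of "fst c" i] floor_affine_vimage[OF pos(2), of "snd c" j]
    by (cases c) (auto simp: cell_def set_eq_iff)
  have emeasure: "emeasure lborel (cell k) = ennreal (1 / (a * b))" and sets: "cell k \<in> sets lborel"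
    for k
    using pos by (cases k; simp add: cell lborel_prod [symmetric] lborel.emeasure_pair_measure_Times
        ennreal_mult [symmetric])+
  have "has_bochner_integral lborel (indicator (cell k) :: _ \<Rightarrow> real) (1 / (a * b))" for k
    using has_bochner_integral_real_indicator[OF sets[of k]] emeasure[of k] pos
    by (simp add: measure_def)
  then have "has_bochner_integral lborel (\<lambda>p. \<Sum>k\<in>I. g k * indicator (cell k) p)
      (\<Sum>k\<in>I. g k * (1 / (a * b)))"
    by (intro has_bochner_integral_sum has_bochner_integral_mult_right)
  moreover have "(\<Sum>k\<in>I. g k * indicator (cell k) p) = g (floor_pair (c + scale_pair a b p))" for p
  proof -
    have "(\<Sum>k\<in>I. g k * indicator (cell k) p) =
        (\<Sum>k\<in>I. if k = floor_pair (c + scale_pair a b p) then g k else 0)"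
      by (intro sum.cong refl) (auto simp: cell_def)
    then show ?thesis
      using \<open>finite I\<close> support by simp
  qed
  ultimately show ?thesis
    by (simp add: sum_divide_distrib)
qed

text \<open>The lattice point below \<open>c + scale_pair a b p\<close>, in the coordinates of \<open>p\<close>.\<close>

definition lattice_round :: "real \<times> real \<Rightarrow> real \<Rightarrow> real \<Rightarrow> real \<times> real \<Rightarrow> real \<times> real" where
  "lattice_round c a b p =
     scale_pair (1 / a) (1 / b) (of_int_pair (floor_pair (c + scale_pair a b p)) - c)"

lemma scale_pair_lattice_round:
  assumes "a > 0" "b > 0"
  shows "c + scale_pair a b (lattice_round c a b p) = of_int_pair (floor_pair (c + scale_pair a b p))"
  using assms by (cases c; cases p) (simp add: lattice_round_def)

lemma dist_lattice_round_le:
  assumes "a > 0" "b > 0"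
  shows "dist (lattice_round c a b p) p \<le> 1 / a + 1 / b"
proof -
  have close: "\<bar>1 / d * (of_int \<lfloor>z + d * x\<rfloor> - z) - x\<bar> \<le> 1 / d" if "d > 0" for d x z :: real
  proof -
    have "1 / d * (of_int \<lfloor>z + d * x\<rfloor> - z) - x = (of_int \<lfloor>z + d * x\<rfloor> - (z + d * x)) / d"
      using that by (simp add: field_simps)
    moreover have "\<bar>of_int \<lfloor>z + d * x\<rfloor> - (z + d * x)\<bar> \<le> 1" by linarith
    ultimately show ?thesis
      using that by (simp add: divide_right_mono)
  qed
  have "norm z \<le> \<bar>fst z\<bar> + \<bar>snd z\<bar>" for z :: "real \<times> real"
    using norm_Pair_le[of "fst z" "snd z"] by simp
  then have "dist (lattice_round c a b p) p \<le>
     \<bar>fst (lattice_round c a b p - p)\<bar> + \<bar>snd (lattice_round c a b p - p)\<bar>"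
    unfolding dist_norm .
  also have "\<dots> \<le> 1 / a + 1 / b"
    using close[OF assms(1), of "fst c" "fst p"] close[OF assms(2), of "snd c" "snd p"]
    by (simp add: lattice_round_def)
  finally show ?thesis .
qed

locale laplace_lattice =
  fixes L :: "nat \<Rightarrow> real \<times> real \<Rightarrow> real" and S :: "nat \<Rightarrow> (real \<times> real) set"
    and c :: "nat \<Rightarrow> real \<times> real" and A B :: "nat \<Rightarrow> real"
  assumes concave: "\<forall>\<^sub>F n in sequentially. concave_on (S n) (L n)"
    and bounded: "\<forall>\<^sub>F n in sequentially. bounded (S n)"
    and scales: "filterlim A at_top sequentially" "filterlim B at_top sequentially"
    and inner: "\<And>K. \<forall>\<^sub>F n in sequentially. \<forall>p\<in>cball 0 K. c n + scale_pair (A n) (B n) p \<in> S n"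
    and gaussian: "\<And>K. uniform_limit (cball 0 K)
           (\<lambda>n p. L n (c n + scale_pair (A n) (B n) p) - L n (c n)) (\<lambda>p. - (norm p)\<^sup>2 / 2) sequentially"
begin

definition profile :: "nat \<Rightarrow> real \<times> real \<Rightarrow> real" where
  "profile n p = L n (c n + scale_pair (A n) (B n) p) - L n (c n)"

definition weight :: "nat \<Rightarrow> int \<times> int \<Rightarrow> real" where
  "weight n k = (if of_int_pair k \<in> S n then exp (L n (of_int_pair k) - L n (c n)) else 0)"

definition step :: "nat \<Rightarrow> real \<times> real \<Rightarrow> real" where
  "step n p = weight n (floor_pair (c n + scale_pair (A n) (B n) p))"

lemma eventually_scales_ge_1: "\<forall>\<^sub>F n in sequentially. 1 \<le> A n \<and> 1 \<le> B n"
  using scales by (simp add: filterlim_at_top eventually_conj)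

lemma step_eq_exp_profile:
  assumes "A n > 0" "B n > 0" and "q = lattice_round (c n) (A n) (B n) p"
  shows "step n p = (if c n + scale_pair (A n) (B n) q \<in> S n then exp (profile n q) else 0)"
  unfolding step_def weight_def profile_def assms(3) scale_pair_lattice_round[OF assms(1,2)] ..

lemma eventually_integral_step:
  "\<forall>\<^sub>F n in sequentially. has_bochner_integral lborel (step n)
     ((\<Sum>k | of_int_pair k \<in> S n. exp (L n (of_int_pair k))) / (A n * B n * exp (L n (c n))))"
  using eventually_scales_ge_1 bounded
proof eventually_elim
  case (elim n)
  let ?I = "{k. of_int_pair k \<in> S n}"
  have "(\<Sum>k\<in>?I. weight n k) = (\<Sum>k\<in>?I. exp (L n (of_int_pair k))) / exp (L n (c n))"
    unfolding sum_divide_distrib by (intro sum.cong refl) (simp add: weight_def exp_diff)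
  moreover have "has_bochner_integral lborel (step n) ((\<Sum>k\<in>?I. weight n k) / (A n * B n))"
    unfolding step_def using elim
    by (intro has_bochner_integral_lattice_step finite_lattice_points) (auto simp: weight_def)
  ultimately show ?case
    by (simp add: mult_ac)
qed

lemma eventually_profile_decay:
  "\<forall>\<^sub>F n in sequentially. \<forall>p. c n + scale_pair (A n) (B n) p \<in> S n \<longrightarrow> profile n p \<le> 1/2 - norm p / 4"
proof -
  have "\<forall>\<^sub>F n in sequentially. \<forall>p\<in>cball 0 1. dist (profile n p) (- (norm p)\<^sup>2 / 2) < 1/4"
    using uniform_limitD[OF gaussian[of 1], of "1/4"] by (simp add: profile_def)
  then show ?thesis
    using concave inner[of 1]
  proof eventually_elim
    case (elim n)
    let ?D = "{p. c n + scale_pair (A n) (B n) p \<in> S n}"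
    have "concave_on ?D (\<lambda>p. L n (c n + scale_pair (A n) (B n) p))"
      using elim by (intro concave_on_compose_affine linear_scale_pair)
    then have conc: "concave_on ?D (profile n)"
      unfolding profile_def
      by (intro concave_on_diff) (auto simp: convex_on_const dest: concave_on_imp_convex)
    have near: "profile n p \<le> 1/4 - (norm p)\<^sup>2 / 2" if "norm p \<le> 1" for p
    proof -
      have "dist (profile n p) (- (norm p)\<^sup>2 / 2) < 1/4"
        using elim(1) that by simp
      then show ?thesis
        unfolding dist_real_def by argo
    qed
    have "profile n p \<le> 2 * (1/4) - 1/4 * norm p" if "p \<in> ?D" for p
    proof (rule concave_on_linear_decay[OF conc _ _ _ _ that])
      show "0 \<in> ?D" "0 \<le> profile n 0"
        using bspec[OF elim(3), of 0] by (auto simp: profile_def linear_0[OF linear_scale_pair])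
      show "profile n p \<le> 1/4" if "norm p \<le> 1" for p
        using near[OF that] zero_le_power2[of "norm p"] by linarith
      show "profile n p \<le> - (1/4)" if "norm p = 1" for p
        using near[of p] that by simp
    qed
    then show ?case by auto
  qed
qed

lemma eventually_step_le:
  "\<forall>\<^sub>F n in sequentially. \<forall>p. norm (step n p) \<le> exp 1 * exp (- (1/4) * norm p)"
  using eventually_scales_ge_1 eventually_profile_decay
proof eventually_elim
  case (elim n)
  show ?case
  proof
    fix p
    define q where "q = lattice_round (c n) (A n) (B n) p"
    have pos: "A n > 0" "B n > 0"
      using elim by auto
    have "dist q p \<le> 1 / A n + 1 / B n"
      unfolding q_def by (intro dist_lattice_round_le pos)
    also have "\<dots> \<le> 1 + 1"
      using elim by (intro add_mono) auto
    finally have "norm p \<le> norm q + 2"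
      using norm_triangle_ineq2[of p q] by (simp add: dist_norm norm_minus_commute)
    then have "profile n q \<le> 1 + - (1/4) * norm p" if "c n + scale_pair (A n) (B n) q \<in> S n"
      using elim(2) that by fastforce
    then show "norm (step n p) \<le> exp 1 * exp (- (1/4) * norm p)"
      unfolding step_eq_exp_profile[OF pos q_def] exp_add[symmetric] by simp
  qed
qed

lemma step_tendsto: "(\<lambda>n. step n p) \<longlonglongrightarrow> exp (- (norm p)\<^sup>2 / 2)"
proof -
  define q where "q n = lattice_round (c n) (A n) (B n) p" for n
  have inverse_scales: "(\<lambda>n. 1 / A n + 1 / B n) \<longlonglongrightarrow> 0 + 0"
    using scales
    by (intro tendsto_add tendsto_divide_0[OF tendsto_const] filterlim_at_top_imp_at_infinity)
  have q_tendsto: "q \<longlonglongrightarrow> p"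
    unfolding tendsto_dist_iff[of q]
  proof (rule Lim_null_comparison)
    show "\<forall>\<^sub>F n in sequentially. norm (dist (q n) p) \<le> 1 / A n + 1 / B n"
      using eventually_scales_ge_1 by eventually_elim (simp add: q_def dist_lattice_round_le)
  qed (use inverse_scales in simp)
  then have "\<forall>\<^sub>F n in sequentially. dist (q n) p < 1"
    by (rule tendstoD) simp
  then have q_bounded: "\<forall>\<^sub>F n in sequentially. q n \<in> cball 0 (norm p + 1)"
  proof eventually_elim
    case (elim n)
    then show ?case
      using norm_triangle_ineq2[of "q n" p] by (simp add: dist_norm)
  qed
  have "(\<lambda>n. profile n (q n)) \<longlonglongrightarrow> - (norm p)\<^sup>2 / 2"
    unfolding profile_def
    by (rule tendsto_uniform_limit_compose[OF gaussian q_tendsto q_bounded]) (intro continuous_intros; simp)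
  then have "(\<lambda>n. exp (profile n (q n))) \<longlonglongrightarrow> exp (- (norm p)\<^sup>2 / 2)"
    by (rule tendsto_exp)
  moreover have "\<forall>\<^sub>F n in sequentially. exp (profile n (q n)) = step n p"
    using inner[of "norm p + 1"] q_bounded eventually_scales_ge_1
    by eventually_elim (simp add: step_eq_exp_profile[OF _ _ q_def])
  ultimately show ?thesis
    by (rule Lim_transform_eventually)
qed

theorem lattice_sum_asymp_equiv:
  "(\<lambda>n. \<Sum>k | of_int_pair k \<in> S n. exp (L n (of_int_pair k)))
     \<sim>[sequentially] (\<lambda>n. 2 * pi * (A n * B n * exp (L n (c n))))"
proof -
  let ?ratio = "\<lambda>n. (\<Sum>k | of_int_pair k \<in> S n. exp (L n (of_int_pair k)))
      / (A n * B n * exp (L n (c n)))"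
  obtain N where integral: "\<And>n. n \<ge> N \<Longrightarrow> has_bochner_integral lborel (step n) (?ratio n)"
    and bound: "\<And>n p. n \<ge> N \<Longrightarrow> norm (step n p) \<le> exp 1 * exp (- (1/4) * norm p)"
    using eventually_conj[OF eventually_integral_step eventually_step_le]
    unfolding eventually_sequentially by blast
  have "(\<lambda>n. integral\<^sup>L lborel (step (n + N)))
      \<longlonglongrightarrow> integral\<^sup>L lborel (\<lambda>p::real \<times> real. exp (- (norm p)\<^sup>2 / 2))"
  proof (rule integral_dominated_convergence)
    show "integrable lborel (\<lambda>p::real \<times> real. exp 1 * exp (- (1/4) * norm p))"
      by (intro integrable_mult_right integrable_exp_minus_norm) simp
    show "step (n + N) \<in> borel_measurable lborel" for n
      using integral[of "n + N"] by (auto dest: borel_measurable_has_bochner_integral)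
    show "AE p in lborel. (\<lambda>n. step (n + N) p) \<longlonglongrightarrow> exp (- (norm p)\<^sup>2 / 2)"
      by (intro AE_I2 LIMSEQ_ignore_initial_segment step_tendsto)
    show "AE p in lborel. norm (step (n + N) p) \<le> exp 1 * exp (- (1/4) * norm p)" for n
      by (intro AE_I2 bound) simp
  qed simp
  moreover have "integral\<^sup>L lborel (\<lambda>p::real \<times> real. exp (- (norm p)\<^sup>2 / 2)) = 2 * pi"
    using has_bochner_integral_gaussian[where 'a = "real \<times> real"]
    by (simp add: has_bochner_integral_iff power2_eq_square)
  moreover have "integral\<^sup>L lborel (step (n + N)) = ?ratio (n + N)" for n
    using integral[of "n + N"] by (simp add: has_bochner_integral_iff)
  ultimately have "?ratio \<longlonglongrightarrow> 2 * pi"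
    by (intro LIMSEQ_offset[of ?ratio N]) simp
  then have "?ratio \<sim>[sequentially] (\<lambda>_. 2 * pi)"
    by (intro tendsto_imp_asymp_equiv_const) auto
  from asymp_equiv_mult[OF this asymp_equiv_refl[of "\<lambda>n. A n * B n * exp (L n (c n))"]]
  show ?thesis
  proof (rule asymp_equiv_transfer)
    show "\<forall>\<^sub>F n in sequentially. ?ratio n * (A n * B n * exp (L n (c n))) =
        (\<Sum>k | of_int_pair k \<in> S n. exp (L n (of_int_pair k)))"
      using eventually_scales_ge_1 by eventually_elim simp
  qed simp
qed

end

section \<open>The summand after summation over \<open>t\<close>\<close>

definition log_summand :: "real \<Rightarrow> real \<Rightarrow> real \<Rightarrow> real" where
  "log_summand N r s = ln_Gamma (N + 1) + (N - r - s) * ln (1 + r) + (N - r - s + 1) * ln s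
     - ln_Gamma (r + 1) - ln_Gamma (s + 1) - ln_Gamma (N - r - s + 1)"

definition summand_domain :: "real \<Rightarrow> (real \<times> real) set" where
  "summand_domain N = {(r, s). 0 \<le> r \<and> 0 < s \<and> r + s \<le> N}"

lemma sum_power_div_fact_mult_fact:
  fixes x :: "'a::field_char_0"
  shows "(\<Sum>t\<le>m. x ^ (m - t) / (fact t * fact (m - t))) = (1 + x) ^ m / fact m"
proof -
  have "(1 + x) ^ m = (\<Sum>t\<le>m. of_nat (m choose t) * 1 ^ t * x ^ (m - t))"
    by (rule binomial_ring)
  also have "\<dots> = (\<Sum>t\<le>m. fact m * (x ^ (m - t) / (fact t * fact (m - t))))"
    by (intro sum.cong) (auto simp: binomial_fact)
  also have "\<dots> = fact m * (\<Sum>t\<le>m. x ^ (m - t) / (fact t * fact (m - t)))"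
    by (rule sum_distrib_left [symmetric])
  finally show ?thesis by simp
qed

lemma exp_log_summand_nat:
  assumes "0 < s" "r + s \<le> n"
  shows "exp (log_summand (real n) (real r) (real s)) = fact n / (fact r * fact s)
           * real s ^ (n - r - s + 1) * ((1 + real r) ^ (n - r - s) / fact (n - r - s))"
proof -
  define m where "m = n - r - s"
  have m_eq: "real n - real r - real s = real m"
    using assms by (simp add: m_def of_nat_diff)
  have exp_ln_power: "exp (real k * ln x) = x ^ k" if "x > 0" for k x
    using that by (simp add: exp_of_nat_mult)
  have exp_ln_Gamma: "exp (ln_Gamma (real k + 1)) = fact k" for k
    using Gamma_real_pos_exp[of "real k + 1"] Gamma_fact[of k, where 'a = real]
    by (simp add: add_ac)
  have "exp (log_summand (real n) (real r) (real s)) =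
      fact n * (1 + real r) ^ m * real s ^ (m + 1) / fact r / fact s / fact m"
    using assms exp_ln_power[of "1 + real r" m] exp_ln_power[of "real s" "m + 1"]
    unfolding log_summand_def m_eq exp_add exp_diff exp_ln_Gamma by (simp add: add_ac)
  then show ?thesis
    by (simp add: m_def)
qed

lemma sum_over_t_eq_exp_log_summand:
  "(\<Sum>t=0..n. if r + s + t \<le> n
      then fact n / (fact r * fact s * fact t * fact (n - r - s - t))
             * real r ^ (n - r - s - t) * real s ^ (n - r - s + 1)
      else 0) =
   (if 0 < s \<and> r + s \<le> n then exp (log_summand (real n) (real r) (real s)) else 0)"
proof (cases "r + s \<le> n")
  case True
  define m where "m = n - r - s"
  let ?C = "fact n / (fact r * fact s) * real s ^ (m + 1)"
  have "(\<Sum>t=0..n. if r + s + t \<le> n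
      then fact n / (fact r * fact s * fact t * fact (n - r - s - t))
             * real r ^ (n - r - s - t) * real s ^ (n - r - s + 1)
      else 0) = (\<Sum>t\<in>{t\<in>{0..n}. r + s + t \<le> n}. ?C * (real r ^ (m - t) / (fact t * fact (m - t))))"
    unfolding sum.inter_filter[OF finite_atLeastAtMost]
    by (intro sum.cong refl if_cong) (simp add: m_def mult_ac)
  also have "{t\<in>{0..n}. r + s + t \<le> n} = {..m}"
    using True by (auto simp: m_def)
  also have "(\<Sum>t\<le>m. ?C * (real r ^ (m - t) / (fact t * fact (m - t)))) = ?C * ((1 + real r) ^ m / fact m)"
    by (simp only: sum_distrib_left [symmetric] sum_power_div_fact_mult_fact)
  also have "\<dots> = (if 0 < s \<and> r + s \<le> n then exp (log_summand (real n) (real r) (real s)) else 0)"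
    using True exp_log_summand_nat[of s r n] by (cases "s = 0") (simp_all add: m_def)
  finally show ?thesis .
qed (simp add: sum.neutral)

lemma c_sum_eq_lattice_sum:
  "c_sum n = (\<Sum>k | of_int_pair k \<in> summand_domain (real n).
                exp ((\<lambda>(r, s). log_summand (real n) r s) (of_int_pair k)))"
proof -
  let ?term = "\<lambda>r s. exp (log_summand (real n) (real r) (real s))"
  have "c_sum n = (\<Sum>r=0..n. \<Sum>s=0..n. if 0 < s \<and> r + s \<le> n then ?term r s else 0)"
    unfolding c_sum_def sum_over_t_eq_exp_log_summand ..
  also have "\<dots> = (\<Sum>(r, s)\<in>{0..n} \<times> {0..n}. if 0 < s \<and> r + s \<le> n then ?term r s else 0)"
    by (rule sum.cartesian_product)
  also have "\<dots> = (\<Sum>(r, s) | 0 < s \<and> r + s \<le> n. ?term r s)"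
    by (rule sum.mono_neutral_cong_right) (auto split: if_splits)
  also have "\<dots> = (\<Sum>k | of_int_pair k \<in> summand_domain (real n).
      exp ((\<lambda>(r, s). log_summand (real n) r s) (of_int_pair k)))"
    by (rule sum.reindex_bij_witness[where i = "map_prod nat nat" and j = "map_prod int int"])
      (auto simp: summand_domain_def)
  finally show ?thesis .
qed

definition log_summand_dr :: "real \<Rightarrow> real \<Rightarrow> real \<Rightarrow> real" where
  "log_summand_dr N r s =
     - ln (1 + r) - ln s + (N - r - s) / (1 + r) - Digamma (r + 1) + Digamma (N - r - s + 1)"

definition log_summand_ds :: "real \<Rightarrow> real \<Rightarrow> real \<Rightarrow> real" where
  "log_summand_ds N r s =
     - ln (1 + r) - ln s + (N - r - s + 1) / s - Digamma (s + 1) + Digamma (N - r - s + 1)"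

definition log_summand_slope :: "real \<Rightarrow> real \<Rightarrow> real \<Rightarrow> real \<Rightarrow> real \<Rightarrow> real" where
  "log_summand_slope N a b r s = a * log_summand_dr N r s + b * log_summand_ds N r s"

definition log_summand_hess :: "real \<Rightarrow> real \<Rightarrow> real \<Rightarrow> real \<Rightarrow> real \<Rightarrow> real" where
  "log_summand_hess N a b r s = - 2 * (a + b) * (a / (1 + r) + b / s)
     - (N - r - s) * (a / (1 + r))\<^sup>2 - (N - r - s + 1) * (b / s)\<^sup>2
     - a\<^sup>2 * Polygamma 1 (r + 1) - b\<^sup>2 * Polygamma 1 (s + 1)
     - (a + b)\<^sup>2 * Polygamma 1 (N - r - s + 1)"

lemma has_real_derivative_log_summand_line:
  assumes "r + x * a > - 1" "s + x * b > 0" "N - (r + x * a) - (s + x * b) > - 1"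
  shows "((\<lambda>x. log_summand N (r + x * a) (s + x * b)) has_real_derivative
           log_summand_slope N a b (r + x * a) (s + x * b)) (at x)"
proof -
  have "1 + (r + x * a) \<noteq> 0" "s + x * b \<noteq> 0"
    using assms by auto
  then show ?thesis
    unfolding log_summand_def log_summand_slope_def log_summand_dr_def log_summand_ds_def
    using assms
    by (auto intro!: derivative_eq_intros simp: add_ac diff_divide_distrib add_divide_distrib algebra_simps)
qed

lemma has_real_derivative_log_summand_slope_line:
  assumes "r + x * a > - 1" "s + x * b > 0" "N - (r + x * a) - (s + x * b) > - 1"
  shows "((\<lambda>x. log_summand_slope N a b (r + x * a) (s + x * b))
           has_real_derivative log_summand_hess N a b (r + x * a) (s + x * b)) (at x)"
proof -
  define R S m where "R = 1 + (r + x * a)" and "S = s + x * b"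
    and "m = N - (r + x * a) - S"
  have pos: "R > 0" "S > 0" "m + 1 > 0"
    using assms by (auto simp: R_def S_def m_def)
  have poles: "r + x * a + 1 \<notin> \<int>\<^sub>\<le>\<^sub>0" "s + x * b + 1 \<notin> \<int>\<^sub>\<le>\<^sub>0" "N - (r + x * a) - (s + x * b) + 1 \<notin> \<int>\<^sub>\<le>\<^sub>0"
    using assms by (auto intro!: not_nonpos_Ints_real_pos)
  have "((\<lambda>x. log_summand_slope N a b (r + x * a) (s + x * b))
     has_real_derivative
       a * (- (a / R) - b / S + (- (a + b) * R - m * a) / (R * R)
         - Polygamma 1 (r + x * a + 1) * a - Polygamma 1 (m + 1) * (a + b))
     + b * (- (a / R) - b / S + (- (a + b) * S - (m + 1) * b) / (S * S)
         - Polygamma 1 (s + x * b + 1) * b - Polygamma 1 (m + 1) * (a + b))) (at x)"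
    unfolding log_summand_slope_def log_summand_dr_def log_summand_ds_def R_def S_def m_def
    by (rule derivative_eq_intros refl assms poles | use assms in \<open>simp; fail\<close> | simp add: algebra_simps)+
  then show ?thesis
  proof (rule DERIV_cong)
    have quotient: "(- (a + b) * z - y * w) / (z * z) = - (a + b) / z - y * (w / z) / z" if "z > 0"
      for y z w
      using that by (simp add: field_simps)
    show "a * (- (a / R) - b / S + (- (a + b) * R - m * a) / (R * R)
         - Polygamma 1 (r + x * a + 1) * a - Polygamma 1 (m + 1) * (a + b))
     + b * (- (a / R) - b / S + (- (a + b) * S - (m + 1) * b) / (S * S)
         - Polygamma 1 (s + x * b + 1) * b - Polygamma 1 (m + 1) * (a + b)) =
     log_summand_hess N a b (r + x * a) (s + x * b)"
      unfolding log_summand_hess_def R_def[symmetric] S_def[symmetric] m_def[symmetric]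
        quotient[OF pos(1)] quotient[OF pos(2)]
      by (simp add: algebra_simps power2_eq_square add_divide_distrib diff_divide_distrib)
  qed
qed

lemma completed_square_nonneg:
  fixes p w y z :: real
  assumes "0 < w" "1 / w \<le> p"
  shows "0 \<le> y\<^sup>2 * p + 2 * y * z + w * z\<^sup>2"
proof -
  have "0 \<le> (y + w * z)\<^sup>2 / w"
    using assms by simp
  also have "\<dots> = y\<^sup>2 * (1 / w) + 2 * y * z + w * z\<^sup>2"
    using assms by (simp add: field_simps power2_eq_square)
  also have "\<dots> \<le> y\<^sup>2 * p + 2 * y * z + w * z\<^sup>2"
    using mult_left_mono[OF assms(2), of "y\<^sup>2"] by simp
  finally show ?thesis .
qed

lemma quadratic_form_nonneg:
  fixes m p q d X Y :: real
  assumes m_nonneg: "0 \<le> m" and p_ge: "1 / (m + 1) \<le> p" and q_ge: "X\<^sup>2 \<le> q"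
    and signs: "X * Y \<le> 0 \<or> 0 \<le> d * (X + Y)"
  shows "0 \<le> 2 * d * (X + Y) + m * X\<^sup>2 + (m + 1) * Y\<^sup>2 + q + d\<^sup>2 * p"
  using signs
proof
  assume opposite: "X * Y \<le> 0"
  have "0 \<le> d\<^sup>2 * p + 2 * d * (X + Y) + (m + 1) * (X + Y)\<^sup>2"
    using m_nonneg p_ge by (intro completed_square_nonneg) auto
  also have "(m + 1) * (X + Y)\<^sup>2 = (m + 1) * (X\<^sup>2 + Y\<^sup>2) + 2 * ((m + 1) * (X * Y))"
    by (simp add: power2_eq_square algebra_simps)
  finally show ?thesis
    using mult_nonneg_nonpos[OF _ opposite, of "m + 1"] m_nonneg q_ge by (simp add: algebra_simps)
next
  assume "0 \<le> d * (X + Y)"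
  moreover have "0 < p"
    using p_ge m_nonneg by (smt (verit) divide_pos_pos)
  moreover have "0 \<le> q"
    using q_ge zero_le_power2[of X] by linarith
  ultimately show ?thesis
    using m_nonneg by (simp add: mult.assoc)
qed

lemma divide_mult_nonpos_or_sum_mult_nonneg:
  fixes a b p q :: real
  assumes "0 < p" "0 < q"
  shows "a / p * (b / q) \<le> 0 \<or> 0 \<le> (a + b) * (a / p + b / q)"
proof (cases "a * b \<le> 0")
  case True
  then show ?thesis
    using assms by (simp add: divide_nonpos_pos)
next
  case False
  have "(a + b) * (a / p + b / q) = a\<^sup>2 / p + b\<^sup>2 / q + a * b * (1 / p + 1 / q)"
    by (simp add: power2_eq_square algebra_simps add_divide_distrib)
  then show ?thesis
    using assms False by simp
qed

lemma log_summand_hess_nonpos: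
  assumes "r \<ge> 0" "s > 0" "N - r - s \<ge> 0"
  shows "log_summand_hess N a b r s \<le> 0"
proof -
  define m X Y where "m = N - r - s" and "X = a / (1 + r)" and "Y = b / s"
  have "X\<^sup>2 \<le> a\<^sup>2 * Polygamma 1 (r + 1)"
  proof -
    have "(1 / (1 + r)) * (1 / (1 + r)) \<le> 1 / (1 + r) * 1"
      using assms by (intro mult_left_mono) auto
    also have "\<dots> \<le> Polygamma 1 (r + 1)"
      using Polygamma_1_ge[of "r + 1"] assms by (simp add: add_ac)
    finally have "a\<^sup>2 * (1 / (1 + r) * (1 / (1 + r))) \<le> a\<^sup>2 * Polygamma 1 (r + 1)"
      by (rule mult_left_mono) simp
    then show ?thesis
      by (simp add: X_def power_divide power2_eq_square)
  qed
  moreover have "X * Y \<le> 0 \<or> 0 \<le> (a + b) * (X + Y)"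
    unfolding X_def Y_def using assms by (intro divide_mult_nonpos_or_sum_mult_nonneg) auto
  moreover have "1 / (m + 1) \<le> Polygamma 1 (m + 1)"
    using assms by (intro Polygamma_1_ge) (simp add: m_def)
  ultimately have "0 \<le> 2 * (a + b) * (X + Y) + m * X\<^sup>2 + (m + 1) * Y\<^sup>2 + a\<^sup>2 * Polygamma 1 (r + 1)
      + (a + b)\<^sup>2 * Polygamma 1 (m + 1)"
    using assms by (intro quadratic_form_nonneg) (auto simp: m_def)
  moreover have "0 \<le> b\<^sup>2 * Polygamma 1 (s + 1)"
    using Polygamma_1_pos[of "s + 1"] assms by simp
  ultimately show ?thesis
    unfolding log_summand_hess_def m_def[symmetric] X_def[symmetric] Y_def[symmetric] by linarith
qed

lemma concave_onI_line:
  fixes f :: "'a::real_vector \<Rightarrow> real"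
  assumes "convex S"
    and line: "\<And>x y. x \<in> S \<Longrightarrow> y \<in> S \<Longrightarrow> concave_on {0..1} (\<lambda>t. f (x + t *\<^sub>R (y - x)))"
  shows "concave_on S f"
  unfolding concave_on_iff
proof (intro conjI ballI allI impI)
  fix x y and u v :: real
  assume endpoints: "x \<in> S" "y \<in> S" and weights: "0 \<le> u" "0 \<le> v" "u + v = 1"
  have "(1 - v) * f (x + 0 *\<^sub>R (y - x)) + v * f (x + 1 *\<^sub>R (y - x))
      \<le> f (x + ((1 - v) *\<^sub>R 0 + v *\<^sub>R 1) *\<^sub>R (y - x))"
    using weights by (intro concave_onD[OF line[OF endpoints]]) auto
  moreover have "1 - v = u" "x + v *\<^sub>R (y - x) = u *\<^sub>R x + v *\<^sub>R y"
    using weights by (auto simp: algebra_simps simp flip: scaleR_left.add)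
  ultimately show "u * f x + v * f y \<le> f (u *\<^sub>R x + v *\<^sub>R y)"
    by simp
qed (use assms in simp)

lemma bounded_summand_domain: "bounded (summand_domain N)"
  by (rule bounded_subset[OF bounded_cbox[of "(0, 0)" "(N, N)"]]) (auto simp: summand_domain_def)

lemma convex_summand_domain: "convex (summand_domain N)"
proof (rule convexI)
  fix p q :: "real \<times> real" and u v :: real
  assume members: "p \<in> summand_domain N" "q \<in> summand_domain N"
    and weights: "0 \<le> u" "0 \<le> v" "u + v = 1"
  obtain r s r' s' where [simp]: "p = (r, s)" "q = (r', s')"
    by (cases p, cases q) auto
  have "u * (r + s) + v * (r' + s') \<le> N"
    using members weights by (intro convex_bound_le) (auto simp: summand_domain_def)
  moreover have "0 < u * s + v * s'"
    using members weights by (cases "u = 0") (auto simp: summand_domain_def intro!: add_pos_nonneg)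
  ultimately show "u *\<^sub>R p + v *\<^sub>R q \<in> summand_domain N"
    using members weights by (auto simp: summand_domain_def algebra_simps)
qed

lemma concave_on_log_summand: "concave_on (summand_domain N) (\<lambda>(r, s). log_summand N r s)"
proof (rule concave_onI_line[OF convex_summand_domain])
  fix p q
  assume endpoints: "p \<in> summand_domain N" "q \<in> summand_domain N"
  obtain r s a b where p_eq: "p = (r, s)" and diff_eq: "q - p = (a, b)"
    by (cases p, cases "q - p") auto
  have in_domain: "0 \<le> r + t * a" "0 < s + t * b" "0 \<le> N - (r + t * a) - (s + t * b)" if "t \<in> {0..1}"
    for t
  proof -
    have "(1 - t) *\<^sub>R p + t *\<^sub>R q \<in> summand_domain N"
      using that endpoints by (intro convexD[OF convex_summand_domain]) auto
    also have "(1 - t) *\<^sub>R p + t *\<^sub>R q = p + t *\<^sub>R (q - p)"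
      by (simp add: algebra_simps)
    finally show "0 \<le> r + t * a" "0 < s + t * b" "0 \<le> N - (r + t * a) - (s + t * b)"
      unfolding diff_eq unfolding p_eq by (auto simp: summand_domain_def)
  qed
  have "concave_on {0..1} (\<lambda>t. log_summand N (r + t * a) (s + t * b))"
  proof (rule f''_le0_imp_concave)
    fix t :: real
    assume t_in_unit: "t \<in> {0..1}"
    show "((\<lambda>t. log_summand N (r + t * a) (s + t * b)) has_real_derivative
        log_summand_slope N a b (r + t * a) (s + t * b)) (at t)"
      by (rule has_real_derivative_log_summand_line) (use in_domain[OF t_in_unit] in auto)
    show "((\<lambda>t. log_summand_slope N a b (r + t * a) (s + t * b))
        has_real_derivative log_summand_hess N a b (r + t * a) (s + t * b)) (at t)"
      by (rule has_real_derivative_log_summand_slope_line) (use in_domain[OF t_in_unit] in auto)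
    show "log_summand_hess N a b (r + t * a) (s + t * b) \<le> 0"
      by (rule log_summand_hess_nonpos) (use in_domain[OF t_in_unit] in auto)
  qed simp
  then show "concave_on {0..1} (\<lambda>t. (\<lambda>(r, s). log_summand N r s) (p + t *\<^sub>R (q - p)))"
    unfolding diff_eq unfolding p_eq by simp
qed

lemma log_summand_taylor:
  assumes "\<And>z. z \<in> {0..1} \<Longrightarrow> 0 \<le> r + z * a \<and> 0 < s + z * b \<and> 0 \<le> N - (r + z * a) - (s + z * b)"
  obtains z where "z \<in> {0..1}"
    "log_summand N (r + a) (s + b) = log_summand N r s + log_summand_slope N a b r s
        + log_summand_hess N a b (r + z * a) (s + z * b) / 2"
proof -
  let ?D = "\<lambda>k::nat. if k = 0 then (\<lambda>z. log_summand N (r + z * a) (s + z * b))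
    else if k = 1 then (\<lambda>z. log_summand_slope N a b (r + z * a) (s + z * b))
    else (\<lambda>z. log_summand_hess N a b (r + z * a) (s + z * b))"
  have "\<exists>z>0. z < 1 \<and> ?D 0 1 = (\<Sum>m<2. ?D m 0 / fact m * 1 ^ m) + ?D 2 z / fact 2 * 1 ^ 2"
  proof (rule Maclaurin)
    show "\<forall>m z. m < 2 \<and> 0 \<le> z \<and> z \<le> 1 \<longrightarrow> (?D m has_real_derivative ?D (Suc m) z) (at z)"
    proof safe
      fix m :: nat and z :: real
      assume "m < 2" "0 \<le> z" "z \<le> 1"
      moreover have "r + z * a > - 1" "s + z * b > 0" "N - (r + z * a) - (s + z * b) > - 1"
        using assms[of z] calculation by auto
      ultimately show "(?D m has_real_derivative ?D (Suc m) z) (at z)"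
        by (auto simp: less_2_cases_iff
            intro!: has_real_derivative_log_summand_line has_real_derivative_log_summand_slope_line)
    qed
  qed auto
  then obtain z where "0 < z" "z < 1" "log_summand N (r + a) (s + b) =
      log_summand N r s + log_summand_slope N a b r s
        + log_summand_hess N a b (r + z * a) (s + z * b) / 2"
    by (auto simp: numeral_2_eq_2)
  then show ?thesis
    by (intro that[of z]) auto
qed

lemma
  fixes w z :: real
  assumes "w > 0"
  shows square_mult_Polygamma_1_nonneg: "0 \<le> z\<^sup>2 * Polygamma 1 (w + 1)"
    and square_mult_Polygamma_1_le: "z\<^sup>2 * Polygamma 1 (w + 1) \<le> z\<^sup>2 / w"
  using assms Polygamma_1_pos[of "w + 1"] mult_left_mono[OF Polygamma_1_plus1_le[OF assms], of "z\<^sup>2"]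
  by auto

lemma log_summand_hess_rescaled:
  fixes N r s X Y :: real
  assumes "0 < N" "0 \<le> r" "0 < s"
  defines "a \<equiv> X * (1 + r) / sqrt N" and "b \<equiv> Y * s / sqrt N"
  shows "log_summand_hess N a b r s + X\<^sup>2 + Y\<^sup>2 =
           (r + s) / N * X\<^sup>2 + (r + s - 1) / N * Y\<^sup>2 - 2 * ((X * (1 + r) + Y * s) / N * (X + Y))
           - a\<^sup>2 * Polygamma 1 (r + 1) - b\<^sup>2 * Polygamma 1 (s + 1)
           - (a + b)\<^sup>2 * Polygamma 1 (N - r - s + 1)"
proof -
  obtain q where sqrt_N: "q > 0" "sqrt N = q" "N = q\<^sup>2"
    using assms(1) by (metis real_sqrt_gt_zero real_sqrt_pow2 less_imp_le)
  have ratios: "a / (1 + r) = X / q" "b / s = Y / q"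
    using assms(2,3) by (simp_all add: a_def b_def sqrt_N(2))
  have "- 2 * (a + b) * (X / q + Y / q) = - 2 * ((X * (1 + r) + Y * s) / N * (X + Y))"
    unfolding a_def b_def sqrt_N(2,3) using sqrt_N(1) by (simp add: field_simps power2_eq_square)
  moreover have "(N - r - s) * (X / q)\<^sup>2 = X\<^sup>2 - (r + s) / N * X\<^sup>2"
    "(N - r - s + 1) * (Y / q)\<^sup>2 = Y\<^sup>2 - (r + s - 1) / N * Y\<^sup>2"
    using sqrt_N(1) by (simp_all add: sqrt_N(3) field_simps)
  ultimately show ?thesis
    unfolding log_summand_hess_def ratios by linarith
qed

lemma divide_mult_square_le:
  fixes w v N Z K :: real
  assumes "0 \<le> w" "w \<le> v" "0 < N" "\<bar>Z\<bar> \<le> K"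
  shows "w / N * Z\<^sup>2 \<le> K\<^sup>2 * (v / N)"
proof -
  have "w / N * Z\<^sup>2 \<le> v / N * K\<^sup>2"
    using assms by (intro mult_mono) (auto simp: divide_right_mono power2_le_iff_abs_le)
  then show ?thesis
    by (simp add: mult.commute)
qed

lemma abs_weighted_sum_le:
  fixes p q X Y K :: real
  assumes "0 \<le> p" "0 \<le> q" "\<bar>X\<bar> \<le> K" "\<bar>Y\<bar> \<le> K"
  shows "\<bar>X * p + Y * q\<bar> \<le> K * (p + q)"
proof -
  have "\<bar>X * p + Y * q\<bar> \<le> \<bar>X\<bar> * p + \<bar>Y\<bar> * q"
    using assms by (intro order_trans[OF abs_triangle_ineq]) (simp add: abs_mult)
  also have "\<dots> \<le> K * p + K * q"
    using assms by (intro add_mono mult_right_mono)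
  finally show ?thesis
    by (simp add: distrib_left)
qed

context
  fixes N r s X Y K a b \<delta> :: real
  assumes domain: "1 \<le> r" "0 < s" "2 * (1 + r + s) \<le> N" and coords_le: "\<bar>X\<bar> \<le> K" "\<bar>Y\<bar> \<le> K"
  defines "a \<equiv> X * (1 + r) / sqrt N" and "b \<equiv> Y * s / sqrt N" and "\<delta> \<equiv> (1 + r + s) / N"
begin

lemma abs_rescaled_sum_le: "\<bar>(X * (1 + r) + Y * s) / N\<bar> \<le> K * \<delta>"
  using abs_weighted_sum_le[of "1 + r" s X K Y] domain coords_le
  by (simp add: \<delta>_def divide_right_mono)

lemma rescaled_trigamma_terms_le:
  shows "a\<^sup>2 * Polygamma 1 (r + 1) \<le> 2 * (K\<^sup>2 * \<delta>)"
    and "b\<^sup>2 * Polygamma 1 (s + 1) \<le> K\<^sup>2 * \<delta>"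
    and "(a + b)\<^sup>2 * Polygamma 1 (N - r - s + 1) \<le> K\<^sup>2 * \<delta>"
proof -
  define D m where "D = (X * (1 + r) + Y * s) / N" and "m = N - r - s"
  have delta_bounds: "0 \<le> \<delta>" "\<delta> \<le> 1/2" and m_bounds: "0 < m" "N \<le> 2 * m"
    using domain by (auto simp: \<delta>_def m_def field_simps)
  have "a\<^sup>2 / r = (1 + r) / N * X\<^sup>2 * ((1 + r) / r)"
    using domain by (simp add: a_def power_divide power_mult_distrib power2_eq_square)
  also have "\<dots> \<le> K\<^sup>2 * \<delta> * 2"
  proof (rule mult_mono)
    show "(1 + r) / N * X\<^sup>2 \<le> K\<^sup>2 * \<delta>"
      unfolding \<delta>_def using domain coords_le by (intro divide_mult_square_le) auto
  qed (use domain delta_bounds in \<open>auto simp: divide_le_eq\<close>)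
  finally show "a\<^sup>2 * Polygamma 1 (r + 1) \<le> 2 * (K\<^sup>2 * \<delta>)"
    using square_mult_Polygamma_1_le[of r a] domain by simp
  have "b\<^sup>2 / s = s / N * Y\<^sup>2"
    using domain by (simp add: b_def power_divide power_mult_distrib power2_eq_square)
  then show "b\<^sup>2 * Polygamma 1 (s + 1) \<le> K\<^sup>2 * \<delta>"
    using square_mult_Polygamma_1_le[of s b] divide_mult_square_le[of s "1 + r + s" N Y K] domain coords_le
    by (simp add: \<delta>_def)
  have "(a + b)\<^sup>2 = D\<^sup>2 * N"
    using domain by (simp add: a_def b_def D_def power_divide flip: add_divide_distrib)
      (simp add: power2_eq_square)
  then have "(a + b)\<^sup>2 / m = D\<^sup>2 * (N / m)" by simp
  also have "\<dots> \<le> (K * \<delta>)\<^sup>2 * 2"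
    using m_bounds abs_rescaled_sum_le domain coords_le delta_bounds
    by (intro mult_mono) (auto simp: D_def power2_le_iff_abs_le divide_le_eq)
  also have "\<dots> = K\<^sup>2 * \<delta> * (2 * \<delta>)"
    by (simp add: power2_eq_square)
  also have "\<dots> \<le> K\<^sup>2 * \<delta> * 1"
    using delta_bounds by (intro mult_left_mono) auto
  finally show "(a + b)\<^sup>2 * Polygamma 1 (N - r - s + 1) \<le> K\<^sup>2 * \<delta>"
    using square_mult_Polygamma_1_le[OF m_bounds(1), of "a + b"] by (simp add: m_def)
qed

lemma abs_log_summand_hess_plus_squares_le:
  "\<bar>log_summand_hess N a b r s + X\<^sup>2 + Y\<^sup>2\<bar> \<le> 10 * (K\<^sup>2 * \<delta>)"
proof -
  define D where "D = (X * (1 + r) + Y * s) / N"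
  have "log_summand_hess N a b r s + X\<^sup>2 + Y\<^sup>2 =
      (r + s) / N * X\<^sup>2 + (r + s - 1) / N * Y\<^sup>2 - 2 * (D * (X + Y))
      - a\<^sup>2 * Polygamma 1 (r + 1) - b\<^sup>2 * Polygamma 1 (s + 1) - (a + b)\<^sup>2 * Polygamma 1 (N - r - s + 1)"
    unfolding a_def b_def D_def using domain by (intro log_summand_hess_rescaled) auto
  moreover have "(r + s) / N * X\<^sup>2 \<le> K\<^sup>2 * \<delta>" "(r + s - 1) / N * Y\<^sup>2 \<le> K\<^sup>2 * \<delta>"
    unfolding \<delta>_def using domain coords_le by (intro divide_mult_square_le; simp)+
  moreover have "0 \<le> (r + s) / N * X\<^sup>2" "0 \<le> (r + s - 1) / N * Y\<^sup>2"
    using domain by auto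
  moreover have "\<bar>D\<bar> * \<bar>X + Y\<bar> \<le> (K * \<delta>) * (2 * K)"
    unfolding D_def using coords_le order_trans[OF abs_ge_zero abs_rescaled_sum_le]
    by (intro mult_mono abs_rescaled_sum_le) auto
  then have "\<bar>D * (X + Y)\<bar> \<le> 2 * (K\<^sup>2 * \<delta>)"
    by (simp add: abs_mult power2_eq_square mult_ac)
  moreover have "0 \<le> a\<^sup>2 * Polygamma 1 (r + 1)" "0 \<le> b\<^sup>2 * Polygamma 1 (s + 1)"
    "0 \<le> (a + b)\<^sup>2 * Polygamma 1 (N - r - s + 1)"
    using domain by (intro square_mult_Polygamma_1_nonneg; simp)+
  moreover note rescaled_trigamma_terms_le
  ultimately show ?thesis
    unfolding abs_le_iff by linarith
qed

end

lemma abs_square_ratio_diff_le: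
  fixes w p p' d K :: real
  assumes "\<bar>w\<bar> \<le> K" "0 < p" "p / 2 \<le> p'" "\<bar>p' - p\<bar> \<le> d"
  shows "\<bar>(w * (p / p'))\<^sup>2 - w\<^sup>2\<bar> \<le> 6 * (K\<^sup>2 * (d / p))"
proof -
  define \<rho> where "\<rho> = p / p'"
  have rho_bounds: "0 \<le> \<rho>" "\<rho> \<le> 2"
    using assms by (auto simp: \<rho>_def divide_le_eq)
  have "\<bar>\<rho> - 1\<bar> = \<bar>p' - p\<bar> / p'"
    using assms by (simp add: \<rho>_def field_simps)
  also have "\<dots> \<le> d / (p / 2)"
    using assms by (intro frac_le) auto
  finally have close: "\<bar>\<rho> - 1\<bar> \<le> 2 * (d / p)"
    by (simp add: mult.commute)
  have "(w * \<rho>)\<^sup>2 - w\<^sup>2 = w\<^sup>2 * ((\<rho> - 1) * (\<rho> + 1))"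
    by (simp add: power2_eq_square algebra_simps)
  then have "\<bar>(w * \<rho>)\<^sup>2 - w\<^sup>2\<bar> = w\<^sup>2 * (\<bar>\<rho> - 1\<bar> * (\<rho> + 1))"
    using rho_bounds by (simp add: abs_mult)
  also have "\<dots> \<le> K\<^sup>2 * (2 * (d / p) * 3)"
    using assms(1) rho_bounds close by (intro mult_mono) (auto simp: power2_le_iff_abs_le)
  finally show ?thesis
    by (simp add: \<rho>_def mult_ac)
qed

lemma abs_log_summand_hess_nearby_le:
  fixes N r s r' s' x y K \<eta> :: real
  assumes domain: "2 \<le> r" "0 < s" "4 * (1 + r + s) \<le> N" and eta_le: "\<eta> \<le> 1/2"
    and near: "\<bar>r' - r\<bar> \<le> \<eta> * r" "\<bar>s' - s\<bar> \<le> \<eta> * s" and coords_le: "\<bar>x\<bar> \<le> K" "\<bar>y\<bar> \<le> K"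
  shows "\<bar>log_summand_hess N (x * r / sqrt N) (y * s / sqrt N) r' s' + x\<^sup>2 + y\<^sup>2\<bar>
           \<le> 60 * (K\<^sup>2 * ((1 + r + s) / N)) + 6 * (K\<^sup>2 * (1 / r + 2 * \<eta>))"
proof -
  define X Y where "X = x * (r / (1 + r'))" and "Y = y * (s / s')"
  have "\<eta> * r \<le> 1/2 * r" "\<eta> * s \<le> 1/2 * s"
    using eta_le domain by (intro mult_right_mono; simp)+
  then have r'_bounds: "r / 2 \<le> r'" "r' \<le> 3/2 * r" and s'_bounds: "s / 2 \<le> s'" "s' \<le> 3/2 * s"
    using near by (auto simp: abs_le_iff)
  have pos: "1 \<le> r'" "0 < s'"
    using r'_bounds s'_bounds domain by auto
  have "\<bar>X\<^sup>2 - x\<^sup>2\<bar> \<le> 6 * (K\<^sup>2 * ((1 + \<eta> * r) / r))"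
    unfolding X_def using coords_le(1) domain r'_bounds near(1)
    by (intro abs_square_ratio_diff_le) auto
  then have X_close: "\<bar>X\<^sup>2 - x\<^sup>2\<bar> \<le> 6 * (K\<^sup>2 * (1 / r)) + 6 * (K\<^sup>2 * \<eta>)"
    using domain by (simp add: add_divide_distrib distrib_left)
  have "\<bar>Y\<^sup>2 - y\<^sup>2\<bar> \<le> 6 * (K\<^sup>2 * (\<eta> * s / s))"
    unfolding Y_def using coords_le(2) domain s'_bounds near(2)
    by (intro abs_square_ratio_diff_le) auto
  then have Y_close: "\<bar>Y\<^sup>2 - y\<^sup>2\<bar> \<le> 6 * (K\<^sup>2 * \<eta>)"
    using domain by simp
  have "r / (1 + r') \<le> 2" "s / s' \<le> 2"
    using pos r'_bounds s'_bounds by (auto simp: divide_le_eq)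
  then have rescaled_coords_le: "\<bar>X\<bar> \<le> K * 2" "\<bar>Y\<bar> \<le> K * 2"
    unfolding X_def Y_def abs_mult using coords_le pos domain by (intro mult_mono; simp)+
  have "x * r / sqrt N = X * (1 + r') / sqrt N" "y * s / sqrt N = Y * s' / sqrt N"
    using pos by (simp_all add: X_def Y_def)
  then have "\<bar>log_summand_hess N (x * r / sqrt N) (y * s / sqrt N) r' s' + X\<^sup>2 + Y\<^sup>2\<bar>
      \<le> 10 * ((K * 2)\<^sup>2 * ((1 + r' + s') / N))"
    using abs_log_summand_hess_plus_squares_le[OF pos _ rescaled_coords_le, of N]
        r'_bounds s'_bounds domain
    by simp
  also have "\<dots> \<le> 10 * ((K * 2)\<^sup>2 * (3/2 * (1 + r + s) / N))"
    using r'_bounds s'_bounds domain by (intro mult_left_mono divide_right_mono) auto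
  finally show ?thesis
    using X_close Y_close by (simp add: power_mult_distrib distrib_left) argo
qed

lemma abs_mult_scaled_le:
  fixes z w p q K :: real
  assumes "z \<in> {0..1}" "\<bar>w\<bar> \<le> K" "0 < p" "0 < q"
  shows "\<bar>z * (w * p / q)\<bar> \<le> K / q * p"
proof -
  have "\<bar>z * (w * p / q)\<bar> = \<bar>z\<bar> * (\<bar>w\<bar> / q) * p"
    using assms by (simp add: abs_mult)
  also have "\<dots> \<le> 1 * (K / q) * p"
    using assms by (intro mult_right_mono mult_mono divide_right_mono) auto
  finally show ?thesis by simp
qed

lemma
  fixes N r s x y K :: real
  assumes domain: "2 \<le> r" "0 < s" "4 * (1 + r + s) \<le> N" and K_le: "2 * K \<le> sqrt N"
    and coords_le: "\<bar>x\<bar> \<le> K" "\<bar>y\<bar> \<le> K"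
  defines "a \<equiv> x * r / sqrt N" and "b \<equiv> y * s / sqrt N"
  shows shifted_in_summand_domain: "(r + a, s + b) \<in> summand_domain N"
    and abs_log_summand_quadratic_approx_le:
      "\<bar>log_summand N (r + a) (s + b) - log_summand N r s + (x\<^sup>2 + y\<^sup>2) / 2\<bar>
         \<le> \<bar>log_summand_slope N a b r s\<bar>
           + (30 * (K\<^sup>2 * ((1 + r + s) / N)) + 3 * (K\<^sup>2 * (1 / r + 2 * (K / sqrt N))))"
proof -
  define \<eta> where "\<eta> = K / sqrt N"
  have sqrt_pos: "sqrt N > 0"
    using domain by simp
  have eta_le: "\<eta> \<le> 1/2"
    using K_le sqrt_pos by (simp add: \<eta>_def divide_le_eq)
  have near: "\<bar>z * a\<bar> \<le> \<eta> * r" "\<bar>z * b\<bar> \<le> \<eta> * s" if "z \<in> {0..1}" for z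
    unfolding a_def b_def \<eta>_def using domain coords_le sqrt_pos
    by (intro abs_mult_scaled_le[OF that]; simp)+
  have half: "\<eta> * r \<le> 1/2 * r" "\<eta> * s \<le> 1/2 * s"
    using eta_le domain by (intro mult_right_mono; simp)+
  have in_domain: "0 \<le> r + z * a \<and> 0 < s + z * b \<and> 0 \<le> N - (r + z * a) - (s + z * b)" if "z \<in> {0..1}"
    for z
    using near[OF that] half domain unfolding abs_le_iff by argo
  show "(r + a, s + b) \<in> summand_domain N"
    using in_domain[of 1] by (simp add: summand_domain_def)
  obtain z where z_in_unit: "z \<in> {0..1}" and taylor:
    "log_summand N (r + a) (s + b) = log_summand N r s + log_summand_slope N a b r s
        + log_summand_hess N a b (r + z * a) (s + z * b) / 2"
    using log_summand_taylor[OF in_domain] by blast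
  have "\<bar>log_summand_hess N a b (r + z * a) (s + z * b) + x\<^sup>2 + y\<^sup>2\<bar>
      \<le> 60 * (K\<^sup>2 * ((1 + r + s) / N)) + 6 * (K\<^sup>2 * (1 / r + 2 * \<eta>))"
    unfolding a_def b_def
    using near[OF z_in_unit]
    by (intro abs_log_summand_hess_nearby_le domain eta_le coords_le) (simp_all add: a_def b_def)
  then show "\<bar>log_summand N (r + a) (s + b) - log_summand N r s + (x\<^sup>2 + y\<^sup>2) / 2\<bar>
           \<le> \<bar>log_summand_slope N a b r s\<bar>
             + (30 * (K\<^sup>2 * ((1 + r + s) / N)) + 3 * (K\<^sup>2 * (1 / r + 2 * (K / sqrt N))))"
    unfolding taylor \<eta>_def[symmetric] by argo
qed

section \<open>Critical points of \<open>F\<close>\<close>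

definition log_F_dr :: "real \<Rightarrow> real \<Rightarrow> real \<Rightarrow> real \<Rightarrow> real" where
  "log_F_dr N r s t =
     - ln r - ln s + (N - r - s - t) / r - Digamma (r + 1) + Digamma (N - r - s - t + 1)"

definition log_F_ds :: "real \<Rightarrow> real \<Rightarrow> real \<Rightarrow> real \<Rightarrow> real" where
  "log_F_ds N r s t =
     - ln r - ln s + (N - r - s + 1) / s - Digamma (s + 1) + Digamma (N - r - s - t + 1)"

definition log_F_dt :: "real \<Rightarrow> real \<Rightarrow> real \<Rightarrow> real \<Rightarrow> real" where
  "log_F_dt N r s t = - ln r - Digamma (t + 1) + Digamma (N - r - s - t + 1)"

definition log_F_slope ::
  "real \<Rightarrow> real \<Rightarrow> real \<Rightarrow> real \<Rightarrow> real \<Rightarrow> real \<Rightarrow> real \<Rightarrow> real" where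
  "log_F_slope N a b c r s t = a * log_F_dr N r s t + b * log_F_ds N r s t + c * log_F_dt N r s t"

definition log_F_hess :: "real \<Rightarrow> real \<Rightarrow> real \<Rightarrow> real \<Rightarrow> real \<Rightarrow> real \<Rightarrow> real \<Rightarrow> real" where
  "log_F_hess N a b c r s t = - 2 * (a + b + c) * (a / r) - 2 * (a + b) * (b / s)
     - (N - r - s - t) * (a / r)\<^sup>2 - (N - r - s + 1) * (b / s)\<^sup>2
     - a\<^sup>2 * Polygamma 1 (r + 1) - b\<^sup>2 * Polygamma 1 (s + 1) - c\<^sup>2 * Polygamma 1 (t + 1)
     - (a + b + c)\<^sup>2 * Polygamma 1 (N - r - s - t + 1)"

lemma critical_iff:
  "critical n r s t \<longleftrightarrow> r > 0 \<and> s > 0 \<and> t > 0 \<and> r + s + t < real n \<and>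
     log_F_dr (real n) r s t = 0 \<and> log_F_ds (real n) r s t = 0 \<and> log_F_dt (real n) r s t = 0"
  by (simp add: critical_def log_F_dr_def log_F_ds_def log_F_dt_def)

locale critical_point =
  fixes n :: nat and r s t :: real
  assumes critical: "critical n r s t"
begin

abbreviation u :: real where "u \<equiv> real n - r - s - t"

lemma positive: "0 < r" "0 < s" "0 < t" "0 < u"
  using critical by (auto simp: critical_def)

lemma
  shows stationary_r: "u / r = ln s + Digamma (r + 1) - Digamma (t + 1)"
    and stationary_s: "(u + t + 1) / s = ln s + Digamma (s + 1) - Digamma (t + 1)"
    and stationary_t: "Digamma (u + 1) = ln r + Digamma (t + 1)"
  using critical unfolding critical_def by (auto simp: algebra_simps)

lemma u_le_r_mult: "u \<le> r * (t + 1)"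
proof -
  have "ln u \<le> ln r + ln (t + 1)"
    using stationary_t ln_le_Digamma_plus1[OF positive(4)] Digamma_le_ln[of "t + 1"] positive
    by simp
  then have "ln u \<le> ln (r * (t + 1))"
    using positive by (simp add: ln_mult)
  then show ?thesis
    using positive by simp
qed

lemma r_mult_t_le: "r * t \<le> u + 1"
proof -
  have "ln r + ln t \<le> ln (u + 1)"
    using stationary_t Digamma_le_ln[of "u + 1"] ln_le_Digamma_plus1[of t] positive by simp
  then have "ln (r * t) \<le> ln (u + 1)"
    using positive by (simp add: ln_mult)
  then show ?thesis
    using positive by (subst (asm) ln_le_cancel_iff) auto
qed

lemma r_less_s: "r < s"
proof (rule ccontr)
  assume "\<not> r < s"
  then have "u / r \<le> u / s"
    using positive by (intro divide_left_mono) auto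
  also have "\<dots> < (u + t + 1) / s"
    using positive by (simp add: divide_strict_right_mono)
  finally have "Digamma (r + 1) < Digamma (s + 1)"
    using stationary_r stationary_s by simp
  moreover have "Digamma (s + 1) \<le> Digamma (r + 1)"
    using \<open>\<not> r < s\<close> positive by (intro Digamma_real_mono) auto
  ultimately show False by simp
qed

lemma u_over_r_le: "u / r \<le> 2 * ln (real n + 1) + 1"
proof -
  have "ln s \<le> ln (real n + 1)" "ln (r + 1) \<le> ln (real n + 1)"
    using positive by auto
  then show ?thesis
    using stationary_r Digamma_le_ln[of "r + 1"] Digamma_plus1_ge_minus_1[of t] positive by linarith
qed

lemma two_ln_s_le: "2 * ln s \<le> (u + t + 1) / s + ln (t + 1)"
  using stationary_s ln_le_Digamma_plus1[of s] Digamma_le_ln[of "t + 1"] positive by linarith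

lemma r_ge_1:
  assumes "real n \<ge> 5 * exp 9 + 2"
  shows "r \<ge> 1"
proof (rule ccontr)
  assume "\<not> r \<ge> 1"
  then have "r * (t + 1) \<le> 1 * (t + 1)"
    using positive by (intro mult_right_mono) auto
  then have u_le_t: "u \<le> t + 1"
    using u_le_r_mult by simp
  have "ln t \<le> ln s + ln (r + 1)"
    using stationary_r positive Digamma_le_ln[of "r + 1"] ln_le_Digamma_plus1[of t]
      divide_pos_pos[of u r] by simp
  also have "\<dots> \<le> ln s + ln 2"
    using \<open>\<not> r \<ge> 1\<close> positive by simp
  finally have "ln t \<le> ln (s * 2)"
    using positive by (simp add: ln_mult)
  then have t_le_s: "t \<le> 2 * s"
    using positive by simp
  then have "exp 9 \<le> s"
    using u_le_t \<open>\<not> r \<ge> 1\<close> assms by simp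
  then have ln_s_ge: "9 \<le> ln s"
    using positive by (simp add: ln_ge_iff)
  then have "1 \<le> s"
    using positive by (smt (verit) ln_le_zero_iff)
  have "(u + t + 1) / s \<le> (6 * s) / s"
    using u_le_t t_le_s \<open>1 \<le> s\<close> by (intro divide_right_mono) auto
  moreover have "ln (t + 1) \<le> ln (3 * s)"
    using t_le_s \<open>1 \<le> s\<close> positive by simp
  moreover have "ln (3 * s) \<le> 2 + ln s"
    using \<open>1 \<le> s\<close> ln_le_minus_one[of "3::real"] by (simp add: ln_mult)
  ultimately have "ln s \<le> 8"
    using two_ln_s_le \<open>1 \<le> s\<close> by simp
  with ln_s_ge show False by simp
qed

lemma t_le_ln:
  assumes "1 \<le> r"
  shows "t \<le> 2 * ln (real n + 1) + 2"
proof -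
  have "t \<le> (u + 1) / r"
    using r_mult_t_le positive by (simp add: field_simps)
  also have "\<dots> = u / r + 1 / r"
    by (simp add: add_divide_distrib)
  also have "\<dots> \<le> 2 * ln (real n + 1) + 1 + 1"
    using u_over_r_le assms by (intro add_mono) auto
  finally show ?thesis by simp
qed

lemma s_leI:
  assumes "1 \<le> r" "0 < y" "(real n + 1) / y + ln (3 + 2 * ln (real n + 1)) < 2 * ln y"
  shows "s \<le> y"
proof (rule ccontr)
  assume "\<not> s \<le> y"
  then have "ln y \<le> ln s" "(u + t + 1) / s \<le> (real n + 1) / y"
    using assms(2) positive by (auto intro!: frac_le)
  moreover have "ln (t + 1) \<le> ln (3 + 2 * ln (real n + 1))"
    using t_le_ln[OF assms(1)] positive by simp
  ultimately show False
    using assms(3) two_ln_s_le by linarith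
qed

end

lemma eventually_critical_bounds:
  assumes "\<epsilon> > 0"
  shows "\<forall>\<^sub>F n in sequentially. \<forall>r s t. critical n r s t \<longrightarrow>
           1 \<le> r \<and> r < s \<and> s \<le> \<epsilon> * real n \<and> t \<le> 2 * ln (real n + 1) + 2"
proof -
  have "\<forall>\<^sub>F n::nat in sequentially.
      (real n + 1) / (\<epsilon> * real n) + ln (3 + 2 * ln (real n + 1)) < 2 * ln (\<epsilon> * real n)"
    using assms by real_asymp
  moreover have "\<forall>\<^sub>F n::nat in sequentially. real n \<ge> 5 * exp 9 + 2" by real_asymp
  ultimately show ?thesis
    using eventually_gt_at_top[of 0]
  proof eventually_elim
    case (elim n)
    show ?case
    proof (intro allI impI)
      fix r s t
      assume "critical n r s t"
      then interpret critical_point n r s t by unfold_locales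
      have "1 \<le> r" by (rule r_ge_1[OF elim(2)])
      then show "1 \<le> r \<and> r < s \<and> s \<le> \<epsilon> * real n \<and> t \<le> 2 * ln (real n + 1) + 2"
        using r_less_s t_le_ln s_leI assms elim by simp
    qed
  qed
qed

lemma eventually_critical_halfspace:
  "\<forall>\<^sub>F n in sequentially. \<forall>r s t. critical n r s t \<longrightarrow> 2 * (r + s + t) + 1 \<le> real n"
proof -
  have "\<forall>\<^sub>F n::nat in sequentially. 2 * (2 * (1/16 * real n) + (2 * ln (real n + 1) + 2)) + 1 \<le> real n"
    by real_asymp
  then show ?thesis
    using eventually_critical_bounds[of "1/16", simplified]
    by eventually_elim fastforce
qed

subsection \<open>Uniqueness\<close>

lemma has_real_derivative_log_F_slope_line:
  assumes "r + x * a > 0" "s + x * b > 0" "t + x * c > 0"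
    and "N - (r + x * a) - (s + x * b) - (t + x * c) > 0"
  shows "((\<lambda>x. log_F_slope N a b c (r + x * a) (s + x * b) (t + x * c))
           has_real_derivative log_F_hess N a b c (r + x * a) (s + x * b) (t + x * c)) (at x)"
proof -
  define R S T u where "R = r + x * a" and "S = s + x * b" and "T = t + x * c"
    and "u = N - R - S - T"
  have pos: "R > 0" "S > 0"
    using assms by (auto simp: R_def S_def)
  have poles: "r + x * a + 1 \<notin> \<int>\<^sub>\<le>\<^sub>0" "s + x * b + 1 \<notin> \<int>\<^sub>\<le>\<^sub>0" "t + x * c + 1 \<notin> \<int>\<^sub>\<le>\<^sub>0"
    "N - (r + x * a) - (s + x * b) - (t + x * c) + 1 \<notin> \<int>\<^sub>\<le>\<^sub>0"
    using assms by (auto intro!: not_nonpos_Ints_real_pos)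
  have "((\<lambda>x. log_F_slope N a b c (r + x * a) (s + x * b) (t + x * c))
      has_real_derivative
        a * (- (a / R) - b / S + (- (a + b + c) * R - u * a) / (R * R)
          - Polygamma 1 (R + 1) * a - Polygamma 1 (u + 1) * (a + b + c))
      + b * (- (a / R) - b / S + (- (a + b) * S - (u + T + 1) * b) / (S * S)
          - Polygamma 1 (S + 1) * b - Polygamma 1 (u + 1) * (a + b + c))
      + c * (- (a / R) - Polygamma 1 (T + 1) * c - Polygamma 1 (u + 1) * (a + b + c))) (at x)"
    unfolding log_F_slope_def log_F_dr_def log_F_ds_def log_F_dt_def u_def R_def S_def T_def
    by (rule derivative_eq_intros refl assms poles | use assms in \<open>simp; fail\<close> | simp add: algebra_simps)+
  then show ?thesis
  proof (rule DERIV_cong)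
    have quotient: "(- y * z - v * w) / (z * z) = - y / z - v * (w / z) / z" if "z > 0"
      for v w y z :: real
      using that by (simp add: field_simps)
    have rest: "N - R - S + 1 = u + T + 1"
      by (simp add: u_def)
    show "a * (- (a / R) - b / S + (- (a + b + c) * R - u * a) / (R * R)
          - Polygamma 1 (R + 1) * a - Polygamma 1 (u + 1) * (a + b + c))
      + b * (- (a / R) - b / S + (- (a + b) * S - (u + T + 1) * b) / (S * S)
          - Polygamma 1 (S + 1) * b - Polygamma 1 (u + 1) * (a + b + c))
      + c * (- (a / R) - Polygamma 1 (T + 1) * c - Polygamma 1 (u + 1) * (a + b + c)) =
      log_F_hess N a b c (r + x * a) (s + x * b) (t + x * c)"
      unfolding log_F_hess_def R_def[symmetric] S_def[symmetric] T_def[symmetric] u_def[symmetric] rest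
        quotient[OF pos(1)] quotient[OF pos(2)]
      by (simp add: algebra_simps power2_eq_square add_divide_distrib diff_divide_distrib)
  qed
qed

text \<open>
  The Hessian of \<open>log F\<close> is negative definite only where \<open>N - r - s - t\<close> is not too small; the half-space
  below is convex and, by \<open>eventually_critical_halfspace\<close>, contains all critical points.
\<close>

lemma log_F_hess_neg:
  assumes pos: "r > 0" "s > 0" "t > 0" and half: "2 * (r + s + t) + 1 \<le> N"
    and nonzero: "(a, b, c) \<noteq> (0, 0, 0)"
  shows "log_F_hess N a b c r s t < 0"
proof -
  define u X Y where "u = N - r - s - t" and "X = a / r" and "Y = b / s"
  have u_ge: "r + s + t + 1 \<le> u" and rest: "N - r - s + 1 = u + t + 1"
    using half by (auto simp: u_def)
  have ab_eq: "a = r * X" "b = s * Y"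
    using pos by (auto simp: X_def Y_def)
  have "0 < 2 * (r * X\<^sup>2) + 2 * (s * Y\<^sup>2) + (a + b + c)\<^sup>2 * Polygamma 1 (u + 1)"
  proof (cases "X = 0 \<and> Y = 0")
    case True
    then show ?thesis
      using nonzero ab_eq Polygamma_1_pos[of "u + 1"] u_ge pos by simp
  next
    case False
    then have "0 < 2 * (r * X\<^sup>2) + 2 * (s * Y\<^sup>2)"
      using pos by (cases "X = 0") (auto intro!: add_pos_nonneg)
    then show ?thesis
      using square_mult_Polygamma_1_nonneg[of u "a + b + c"] u_ge pos by simp
  qed
  moreover have "0 \<le> c\<^sup>2 * Polygamma 1 (t + 1) + 2 * c * X + (t + 1) * X\<^sup>2"
    using pos by (intro completed_square_nonneg Polygamma_1_ge) auto
  moreover have "0 \<le> (r + s) * (X + Y)\<^sup>2" "0 \<le> (u - (r + s + t + 1)) * X\<^sup>2"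
    "0 \<le> (u + t + 1 - (r + s)) * Y\<^sup>2"
    using u_ge pos by auto
  moreover have "0 \<le> a\<^sup>2 * Polygamma 1 (r + 1)" "0 \<le> b\<^sup>2 * Polygamma 1 (s + 1)"
    using square_mult_Polygamma_1_nonneg pos by blast+
  moreover have "2 * (a + b + c) * X + 2 * (a + b) * Y + u * X\<^sup>2 + (u + t + 1) * Y\<^sup>2 =
      (r + s) * (X + Y)\<^sup>2 + (2 * c * X + (t + 1) * X\<^sup>2) + (u - (r + s + t + 1)) * X\<^sup>2
        + (u + t + 1 - (r + s)) * Y\<^sup>2 + 2 * (r * X\<^sup>2) + 2 * (s * Y\<^sup>2)"
    unfolding ab_eq by (simp add: power2_eq_square algebra_simps)
  ultimately show ?thesis
    unfolding log_F_hess_def rest u_def[symmetric] X_def[symmetric] Y_def[symmetric] by linarith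
qed

lemma critical_unique_in_halfspace:
  assumes both_critical: "critical n r s t" "critical n r' s' t'"
    and half: "2 * (r + s + t) + 1 \<le> real n" "2 * (r' + s' + t') + 1 \<le> real n"
  shows "(r, s, t) = (r', s', t')"
proof (rule ccontr)
  assume distinct: "(r, s, t) \<noteq> (r', s', t')"
  define a b c where "a = r' - r" and "b = s' - s" and "c = t' - t"
  let ?slope = "\<lambda>x. log_F_slope n a b c (r + x * a) (s + x * b) (t + x * c)"
  have decreasing: "\<exists>D. (?slope has_real_derivative D) (at x) \<and> D < 0" if x_in_unit: "0 \<le> x" "x \<le> 1"
    for x
  proof -
    have segment: "r + x * a = (1 - x) * r + x * r'" "s + x * b = (1 - x) * s + x * s'"
      "t + x * c = (1 - x) * t + x * t'"
      by (simp_all add: a_def b_def c_def algebra_simps)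
    have "0 < (1 - x) * y + x * y'" if "0 < y" "0 < y'" for y y' :: real
      using x_in_unit that by (cases "x = 0") (auto intro!: add_nonneg_pos)
    then have pos: "0 < r + x * a" "0 < s + x * b" "0 < t + x * c"
      unfolding segment using both_critical by (auto simp: critical_def)
    have "0 \<le> (1 - x) * (real n - (2 * (r + s + t) + 1)) + x * (real n - (2 * (r' + s' + t') + 1))"
      using x_in_unit half by (intro add_nonneg_nonneg mult_nonneg_nonneg) auto
    then have inside: "2 * ((r + x * a) + (s + x * b) + (t + x * c)) + 1 \<le> real n"
      unfolding segment by (simp add: algebra_simps)
    have "(?slope has_real_derivative log_F_hess n a b c (r + x * a) (s + x * b) (t + x * c)) (at x)"
      using pos inside by (intro has_real_derivative_log_F_slope_line) auto
    moreover have "log_F_hess n a b c (r + x * a) (s + x * b) (t + x * c) < 0"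
      using distinct by (intro log_F_hess_neg pos inside) (auto simp: a_def b_def c_def)
    ultimately show ?thesis by blast
  qed
  have "?slope 0 > ?slope 1"
    by (rule DERIV_neg_imp_decreasing) (use decreasing in auto)
  then show False
    using both_critical by (simp add: critical_iff log_F_slope_def a_def b_def c_def)
qed

subsection \<open>Existence\<close>

lemma poincare_miranda:
  fixes f :: "'a::euclidean_space \<Rightarrow> 'a"
  assumes nonempty: "cbox a b \<noteq> {}" and continuous: "continuous_on (cbox a b) f"
    and lower: "\<And>x i. x \<in> cbox a b \<Longrightarrow> i \<in> Basis \<Longrightarrow> x \<bullet> i = a \<bullet> i \<Longrightarrow> 0 \<le> f x \<bullet> i"
    and upper: "\<And>x i. x \<in> cbox a b \<Longrightarrow> i \<in> Basis \<Longrightarrow> x \<bullet> i = b \<bullet> i \<Longrightarrow> f x \<bullet> i \<le> 0"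
  obtains x where "x \<in> cbox a b" "f x = 0"
proof -
  let ?P = "closest_point (cbox a b)"
  obtain x where x_in_box: "x \<in> cbox a b" and fixpoint: "?P (x + f x) = x"
  proof (rule brouwer)
    show "continuous_on (cbox a b) (\<lambda>x. ?P (x + f x))"
      by (rule continuous_on_compose2[OF continuous_on_closest_point[of _ UNIV]])
        (use nonempty continuous in \<open>auto intro!: continuous_intros\<close>)
    show "(\<lambda>x. ?P (x + f x)) \<in> cbox a b \<rightarrow> cbox a b"
      using nonempty by (auto intro: closest_point_in_set)
  qed (use nonempty in auto)
  have variational: "f x \<bullet> (y - x) \<le> 0" if "y \<in> cbox a b" for y
    using closest_point_dot[OF convex_box(1) closed_cbox that, of "x + f x"] by (simp add: fixpoint)
  have "f x \<bullet> i = 0" if i_in_Basis: "i \<in> Basis" for i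
  proof -
    have bounds: "a \<bullet> i \<le> x \<bullet> i" "x \<bullet> i \<le> b \<bullet> i"
      using x_in_box i_in_Basis by (auto simp: mem_box)
    have move: "(f x \<bullet> i) * (v - x \<bullet> i) \<le> 0" if "a \<bullet> i \<le> v" "v \<le> b \<bullet> i" for v
    proof -
      have "x + (v - x \<bullet> i) *\<^sub>R i \<in> cbox a b"
        using x_in_box i_in_Basis that by (auto simp: mem_box inner_add_left inner_Basis)
      from variational[OF this] show ?thesis
        by (simp add: mult.commute)
    qed
    have "0 \<le> f x \<bullet> i"
      using move[of "a \<bullet> i"] lower[OF x_in_box i_in_Basis] bounds by (auto simp: mult_le_0_iff)
    moreover have "f x \<bullet> i \<le> 0"
      using move[of "b \<bullet> i"] upper[OF x_in_box i_in_Basis] bounds by (auto simp: mult_le_0_iff)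
    ultimately show ?thesis by simp
  qed
  then have "f x = 0"
    by (rule euclidean_all_zero_iff[THEN iffD1, rule_format])
  with x_in_box show ?thesis by (rule that)
qed

locale critical_box =
  fixes N lo hi t0 t1 :: real
  assumes box: "0 < lo" "lo \<le> hi" "0 < t0" "t0 \<le> t1" "0 < N - 2 * hi - t1"
    and rs_lower: "0 < - ln lo - ln hi + (N - 2 * hi - t1) / lo - ln (lo + 1) + ln (N - 2 * hi - t1)"
    and rs_upper: "- ln hi - ln lo + (N + 1) / hi - ln hi + ln (N + 1) < 0"
    and t_lower: "0 < - ln hi - ln (t0 + 1) + ln (N - 2 * hi - t1)"
    and t_upper: "- ln lo - ln t1 + ln (N + 1) < 0"
begin

abbreviation u0 :: real where "u0 \<equiv> N - 2 * hi - t1"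

context
  fixes r s t :: real
  assumes mem: "r \<in> {lo..hi}" "s \<in> {lo..hi}" "t \<in> {t0..t1}"
begin

lemma box_pos: "0 < r" "0 < s" "0 < t" and box_rest: "u0 \<le> N - r - s - t"
  using mem box by auto

lemma box_ln: "ln lo \<le> ln r" "ln r \<le> ln hi" "ln lo \<le> ln s" "ln s \<le> ln hi"
  using mem box by auto

lemma box_Digamma:
  "ln u0 \<le> Digamma (N - r - s - t + 1)" "Digamma (N - r - s - t + 1) \<le> ln (N + 1)"
proof -
  have "ln u0 \<le> ln (N - r - s - t)"
    using box box_rest by simp
  also have "\<dots> \<le> Digamma (N - r - s - t + 1)"
    using box box_rest by (intro ln_le_Digamma_plus1) auto
  finally show "ln u0 \<le> Digamma (N - r - s - t + 1)" .
  have "Digamma (N - r - s - t + 1) \<le> ln (N - r - s - t + 1)"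
    using box box_rest by (intro Digamma_le_ln) auto
  also have "\<dots> \<le> ln (N + 1)"
    using box box_pos box_rest by simp
  finally show "Digamma (N - r - s - t + 1) \<le> ln (N + 1)" .
qed

lemma log_F_dr_face_lo:
  assumes "r = lo"
  shows "0 < log_F_dr N r s t"
proof -
  have "u0 / r \<le> (N - r - s - t) / r" "Digamma (r + 1) \<le> ln (r + 1)"
    using box_pos box_rest by (auto intro!: divide_right_mono Digamma_le_ln)
  then show ?thesis
    using box_ln box_Digamma rs_lower unfolding log_F_dr_def assms by linarith
qed

lemma log_F_dr_face_hi:
  assumes "r = hi"
  shows "log_F_dr N r s t < 0"
proof -
  have "(N - r - s - t) / r \<le> (N + 1) / r" "ln r \<le> Digamma (r + 1)"
    using box_pos by (auto intro!: divide_right_mono ln_le_Digamma_plus1)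
  then show ?thesis
    using box_ln box_Digamma rs_upper unfolding log_F_dr_def assms by linarith
qed

lemma log_F_ds_face_lo:
  assumes "s = lo"
  shows "0 < log_F_ds N r s t"
proof -
  have "u0 / s \<le> (N - r - s + 1) / s" "Digamma (s + 1) \<le> ln (s + 1)"
    using box_pos box_rest by (auto intro!: divide_right_mono Digamma_le_ln)
  then show ?thesis
    using box_ln box_Digamma rs_lower unfolding log_F_ds_def assms by linarith
qed

lemma log_F_ds_face_hi:
  assumes "s = hi"
  shows "log_F_ds N r s t < 0"
proof -
  have "(N - r - s + 1) / s \<le> (N + 1) / s" "ln s \<le> Digamma (s + 1)"
    using box_pos by (auto intro!: divide_right_mono ln_le_Digamma_plus1)
  then show ?thesis
    using box_ln box_Digamma rs_upper unfolding log_F_ds_def assms by linarith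
qed

lemma log_F_dt_face_lo:
  assumes "t = t0"
  shows "0 < log_F_dt N r s t"
  using Digamma_le_ln[of "t + 1"] box_pos box_ln box_Digamma t_lower
  unfolding log_F_dt_def assms by linarith

lemma log_F_dt_face_hi:
  assumes "t = t1"
  shows "log_F_dt N r s t < 0"
  using ln_le_Digamma_plus1[of t] box_pos box_ln box_Digamma t_upper
  unfolding log_F_dt_def assms by linarith

end

abbreviation gradient :: "real \<times> real \<times> real \<Rightarrow> real \<times> real \<times> real" where
  "gradient \<equiv> \<lambda>(r, s, t). (log_F_dr N r s t, log_F_ds N r s t, log_F_dt N r s t)"

lemma mem_cbox_iff:
  "(r, s, t) \<in> cbox (lo, lo, t0) (hi, hi, t1) \<longleftrightarrow> r \<in> {lo..hi} \<and> s \<in> {lo..hi} \<and> t \<in> {t0..t1}"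
  by (simp add: cbox_Pair_eq)

lemma continuous_on_gradient: "continuous_on (cbox (lo, lo, t0) (hi, hi, t1)) gradient"
proof -
  let ?B = "cbox (lo, lo, t0) (hi, hi, t1)"
  have nonzero: "fst p \<noteq> 0" "fst (snd p) \<noteq> 0"
    and poles: "fst p + 1 \<notin> \<int>\<^sub>\<le>\<^sub>0" "fst (snd p) + 1 \<notin> \<int>\<^sub>\<le>\<^sub>0" "snd (snd p) + 1 \<notin> \<int>\<^sub>\<le>\<^sub>0"
      "N - fst p - fst (snd p) - snd (snd p) + 1 \<notin> \<int>\<^sub>\<le>\<^sub>0" if "p \<in> ?B" for p
    using that box box_pos[of "fst p" "fst (snd p)" "snd (snd p)"]
        box_rest[of "fst p" "fst (snd p)" "snd (snd p)"]
    by (cases p; auto simp: mem_cbox_iff intro!: not_nonpos_Ints_real_pos)+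
  have continuous_Digamma: "continuous_on ?B (\<lambda>p. Digamma (k p))"
    if "continuous_on ?B k" "\<And>p. p \<in> ?B \<Longrightarrow> k p \<notin> \<int>\<^sub>\<le>\<^sub>0" for k :: "real \<times> real \<times> real \<Rightarrow> real"
    by (rule continuous_on_compose2[OF continuous_on_Polygamma[of "- \<int>\<^sub>\<le>\<^sub>0"] that(1)]) (use that(2) in auto)
  show ?thesis
    unfolding case_prod_beta log_F_dr_def log_F_ds_def log_F_dt_def
    by (intro continuous_intros continuous_Digamma ballI nonzero poles; assumption)
qed

theorem ex_stationary:
  "\<exists>r s t. 0 < r \<and> 0 < s \<and> 0 < t \<and> r + s + t < N \<and>
     log_F_dr N r s t = 0 \<and> log_F_ds N r s t = 0 \<and> log_F_dt N r s t = 0"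
proof -
  obtain p where p_zero: "p \<in> cbox (lo, lo, t0) (hi, hi, t1)" "gradient p = 0"
  proof (rule poincare_miranda[OF _ continuous_on_gradient])
    have "(lo, lo, t0) \<in> cbox (lo, lo, t0) (hi, hi, t1)"
      using box by (simp add: mem_cbox_iff)
    then show "cbox (lo, lo, t0) (hi, hi, t1) \<noteq> {}" by blast
  next
    fix p i :: "real \<times> real \<times> real"
    assume p_in_box: "p \<in> cbox (lo, lo, t0) (hi, hi, t1)" and i_in_Basis: "i \<in> Basis"
    show "0 \<le> gradient p \<bullet> i" if "p \<bullet> i = (lo, lo, t0) \<bullet> i"
      using p_in_box i_in_Basis that log_F_dr_face_lo log_F_ds_face_lo log_F_dt_face_lo
      by (cases p) (auto simp: mem_cbox_iff Basis_prod_def less_imp_le)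
    show "gradient p \<bullet> i \<le> 0" if "p \<bullet> i = (hi, hi, t1) \<bullet> i"
      using p_in_box i_in_Basis that log_F_dr_face_hi log_F_ds_face_hi log_F_dt_face_hi
      by (cases p) (auto simp: mem_cbox_iff Basis_prod_def less_imp_le)
  qed
  obtain r s t where p_eq: "p = (r, s, t)"
    by (cases p) auto
  then have "r \<in> {lo..hi}" "s \<in> {lo..hi}" "t \<in> {t0..t1}"
    using p_zero by (auto simp: mem_cbox_iff)
  then have "0 < r" "0 < s" "0 < t" "r + s + t < N"
    using box_pos[of r s t] box_rest[of r s t] box by auto
  with p_zero(2) show ?thesis
    unfolding p_eq by (auto simp: zero_prod_def)
qed

end

lemma eventually_critical_box:
  "\<forall>\<^sub>F n::nat in sequentially. critical_box (real n) (real n / (4 * ln (real n))) (real n / ln (real n))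
     (ln (real n) / 4) ((ln (real n))\<^sup>2)"
  unfolding critical_box_def by (intro eventually_conj) real_asymp+

lemma eventually_ex_critical: "\<forall>\<^sub>F n in sequentially. \<exists>r s t. critical n r s t"
  using eventually_critical_box unfolding critical_iff
  by eventually_elim (rule critical_box.ex_stationary)

theorem eventually_ex1_critical: "\<forall>\<^sub>F n in sequentially. \<exists>!(r, s, t). critical n r s t"
  using eventually_critical_halfspace eventually_ex_critical
proof eventually_elim
  case (elim n)
  then obtain r s t where "critical n r s t" by blast
  then show ?case
    using critical_unique_in_halfspace elim(1) by (intro ex1I[of _ "(r, s, t)"]) fastforce+
qed

section \<open>Asymptotics along the critical points\<close>

context critical_point
begin

lemma F_term_eq_binomial_density:
  "F_term n r s t = exp (log_summand (real n) r s) * binomial_density t u r"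
proof -
  have exp_ln_Gamma: "exp (ln_Gamma (x + 1)) = Gamma (x + 1)" if "x \<ge> 0" for x :: real
    using that by (intro Gamma_real_pos_exp[symmetric]) simp
  define v where "v = u"
  have v_pos: "0 < v" and m_eq: "real n - r - s = t + v"
    using positive by (auto simp: v_def)
  define G P where "G = Gamma (t + v + 1)" and "P = (1 + r) powr (t + v)"
  have nonzero: "G > 0" "P > 0"
    using positive v_pos by (auto simp: G_def P_def)
  have "exp (log_summand (real n) r s) = Gamma (real n + 1) * P * s powr (t + v + 1)
      / Gamma (r + 1) / Gamma (s + 1) / G"
    unfolding log_summand_def m_eq exp_add exp_diff G_def P_def using positive v_pos
    by (simp add: exp_ln_Gamma powr_def)
  then show ?thesis
    unfolding F_term_def rpow_def binomial_density_def v_def[symmetric]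
    unfolding m_eq G_def[symmetric] P_def[symmetric] using positive v_pos nonzero
    by (simp add: mult_ac)
qed

lemma abs_mean_error_le:
  assumes "1 \<le> r"
  shows "\<bar>t * r - u\<bar> \<le> r"
  using assms u_le_r_mult r_mult_t_le by (simp add: abs_le_iff algebra_simps)

lemma abs_mean_shift_le:
  assumes "1 \<le> r"
  shows "\<bar>(u + t) / (1 + r) - u / r\<bar> \<le> 1 / r"
proof -
  have "(u + t) / (1 + r) - u / r = (t * r - u) / (r * (1 + r))"
    using positive by (simp add: field_simps)
  also have "\<bar>\<dots>\<bar> = \<bar>t * r - u\<bar> / (r * (1 + r))"
    using positive by (simp add: abs_mult)
  also have "\<dots> \<le> (1 + r) / (r * (1 + r))"
    using abs_mean_error_le[OF assms] positive by (intro divide_right_mono) auto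
  finally show ?thesis
    using positive by simp
qed

lemma Digamma_shift_le:
  assumes "1 \<le> r" "r \<le> u"
  shows "Digamma (u + t + 1) - Digamma (u + 1) \<le> 3 / r"
proof -
  have "Digamma (u + t + 1) - Digamma (u + 1) \<le> ln (u + t + 1) - ln u"
    using positive Digamma_le_ln[of "u + t + 1"] ln_le_Digamma_plus1[of u] by simp
  also have "\<dots> \<le> (t + 1) / u"
      using positive ln_diff_le[of "u + t + 1" u] by (simp add: add.commute)
  also have "\<dots> \<le> 3 / r"
  proof -
    have "r * (t + 1) \<le> 3 * u"
      using r_mult_t_le assms by (simp add: distrib_left)
    then show ?thesis
      using positive by (simp add: field_simps)
  qed
  finally show ?thesis .
qed

lemma abs_log_summand_partials_le:
  assumes "1 \<le> r" "r \<le> u"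
  shows "\<bar>log_summand_dr (real n) r s\<bar> \<le> 5 / r" "\<bar>log_summand_ds (real n) r s\<bar> \<le> 5 / r"
proof -
  define ln_shift mean_shift Digamma_shift where "ln_shift = ln (1 + r) - ln r"
    and "mean_shift = (u + t) / (1 + r) - u / r"
      and "Digamma_shift = Digamma (u + t + 1) - Digamma (u + 1)"
  have dr_eq: "log_summand_dr (real n) r s = - ln_shift + mean_shift + Digamma_shift"
    and ds_eq: "log_summand_ds (real n) r s = - ln_shift + Digamma_shift"
    unfolding log_summand_dr_def log_summand_ds_def ln_shift_def mean_shift_def Digamma_shift_def
    using stationary_r stationary_s stationary_t by simp_all
  have "0 \<le> ln_shift" "ln_shift \<le> 1 / r"
    using positive ln_diff_le[of "1 + r" r] by (auto simp: ln_shift_def)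
  moreover have "0 \<le> Digamma_shift" "Digamma_shift \<le> 3 / r"
    using positive Digamma_shift_le[OF assms]
    by (auto simp: Digamma_shift_def intro!: Digamma_real_mono)
  moreover have "\<bar>mean_shift\<bar> \<le> 1 / r"
    using abs_mean_shift_le[OF assms(1)] by (simp add: mean_shift_def)
  ultimately show "\<bar>log_summand_dr (real n) r s\<bar> \<le> 5 / r" "\<bar>log_summand_ds (real n) r s\<bar> \<le> 5 / r"
    unfolding dr_eq ds_eq using divide_nonneg_pos[of 1 r] positive by (simp_all add: abs_le_iff)
qed

lemma abs_log_summand_slope_le:
  assumes "1 \<le> r" "r \<le> u" and coords_le: "\<bar>x\<bar> \<le> K" "\<bar>y\<bar> \<le> K"
  shows "\<bar>log_summand_slope (real n) (x * r / sqrt (real n)) (y * s / sqrt (real n)) r s\<bar>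
           \<le> 5 * K * ((r + s) / (r * sqrt (real n)))"
proof -
  let ?dr = "log_summand_dr (real n) r s" and ?ds = "log_summand_ds (real n) r s"
  have sqrt_pos: "sqrt (real n) > 0"
    using positive by simp
  have "\<bar>log_summand_slope (real n) (x * r / sqrt (real n)) (y * s / sqrt (real n)) r s\<bar>
      \<le> \<bar>x\<bar> * r / sqrt (real n) * \<bar>?dr\<bar> + \<bar>y\<bar> * s / sqrt (real n) * \<bar>?ds\<bar>"
    unfolding log_summand_slope_def using positive
    by (intro order_trans[OF abs_triangle_ineq]) (simp add: abs_mult)
  also have "\<dots> \<le> K * r / sqrt (real n) * (5 / r) + K * s / sqrt (real n) * (5 / r)"
    using positive coords_le sqrt_pos abs_log_summand_partials_le[OF assms(1,2)]
    by (intro add_mono mult_mono divide_right_mono mult_right_mono) auto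
  also have "\<dots> = 5 * K * ((r + s) / (r * sqrt (real n)))"
    using positive sqrt_pos by (simp add: field_simps)
  finally show ?thesis .
qed

end

locale critical_sequence =
  fixes r s t :: "nat \<Rightarrow> real"
  assumes critical: "\<forall>\<^sub>F n in sequentially. critical n (r n) (s n) (t n)"
begin

definition u :: "nat \<Rightarrow> real" where
  "u n = real n - r n - s n - t n"

lemma eventually_critical_point:
  "\<forall>\<^sub>F n in sequentially. critical_point n (r n) (s n) (t n) \<and> 0 < n \<and>
     1 \<le> r n \<and> r n < s n \<and> s n \<le> u n \<and> 0 < t n \<and> real n \<le> 2 * u n"
  using critical eventually_critical_bounds[OF zero_less_one] eventually_critical_halfspace
proof eventually_elim
  case (elim n)
  then interpret point: critical_point n "r n" "s n" "t n"
    by unfold_locales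
  have "1 \<le> r n" "r n < s n" "2 * (r n + s n + t n) + 1 \<le> real n"
    using elim by blast+
  then show ?case
    using point.critical_point_axioms point.positive by (simp add: u_def)
qed

lemma s_over_n: "(\<lambda>n. s n / real n) \<longlonglongrightarrow> 0"
proof (rule tendstoI)
  fix e :: real
  assume "e > 0"
  then have "e / 2 > 0" by simp
  show "\<forall>\<^sub>F n in sequentially. dist (s n / real n) 0 < e"
    using critical eventually_critical_bounds[OF \<open>e / 2 > 0\<close>] eventually_critical_point
  proof eventually_elim
    case (elim n)
    then have "s n \<le> e / 2 * real n" by blast
    also have "\<dots> < e * real n"
      using \<open>e > 0\<close> elim by simp
    finally show ?case
      using elim(3) by (simp add: dist_real_def divide_less_eq)
  qed
qed

lemma r_over_n: "(\<lambda>n. r n / real n) \<longlonglongrightarrow> 0"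
proof (rule Lim_null_comparison[OF _ s_over_n])
  show "\<forall>\<^sub>F n in sequentially. norm (r n / real n) \<le> s n / real n"
    using eventually_critical_point by eventually_elim (auto intro!: divide_right_mono)
qed

lemma t_over_n: "(\<lambda>n. t n / real n) \<longlonglongrightarrow> 0"
proof (rule Lim_null_comparison)
  show "\<forall>\<^sub>F n in sequentially. norm (t n / real n) \<le> (2 * ln (real n + 1) + 2) / real n"
    using critical eventually_critical_point eventually_critical_bounds[OF zero_less_one]
  proof eventually_elim
    case (elim n)
    then have "t n \<le> 2 * ln (real n + 1) + 2" "0 < t n" by blast+
    then show ?case
      by (simp add: divide_right_mono)
  qed
  show "(\<lambda>n::nat. (2 * ln (real n + 1) + 2) / real n) \<longlonglongrightarrow> 0" by real_asymp
qed

lemma r_over_sqrt_at_top: "filterlim (\<lambda>n. r n / sqrt (real n)) at_top sequentially"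
proof (rule filterlim_at_top_mono)
  show "filterlim (\<lambda>n. sqrt (real n) / (2 * (2 * ln (real n + 1) + 1))) at_top sequentially"
    by real_asymp
  show "\<forall>\<^sub>F n in sequentially. sqrt (real n) / (2 * (2 * ln (real n + 1) + 1)) \<le> r n / sqrt (real n)"
    using eventually_critical_point
  proof eventually_elim
    case (elim n)
    then interpret point: critical_point n "r n" "s n" "t n" by simp
    have pos: "0 < 2 * ln (real n + 1) + 1" "0 < sqrt (real n)" "sqrt (real n) * sqrt (real n) = real n"
      using elim by (auto intro!: add_nonneg_pos)
    have "u n \<le> (2 * ln (real n + 1) + 1) * r n"
      using point.u_over_r_le point.positive(1) by (simp add: u_def divide_le_eq)
    then have "real n \<le> 2 * (2 * ln (real n + 1) + 1) * r n"
      using elim by (simp add: algebra_simps)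
    then show ?case
      using pos by (simp add: divide_le_eq pos_le_divide_eq mult_ac)
  qed
qed

lemma s_over_sqrt_at_top: "filterlim (\<lambda>n. s n / sqrt (real n)) at_top sequentially"
  by (rule filterlim_at_top_mono[OF r_over_sqrt_at_top])
    (use eventually_critical_point in eventually_elim, auto intro!: divide_right_mono)

lemma r_at_top: "filterlim r at_top sequentially"
proof (rule filterlim_at_top_mono[OF r_over_sqrt_at_top], use eventually_critical_point in eventually_elim)
  case (elim n)
  then have "r n * 1 \<le> r n * sqrt (real n)"
    by (intro mult_left_mono) auto
  then show ?case
    using elim by (simp add: divide_le_eq)
qed

lemma u_at_top: "filterlim u at_top sequentially"
proof (rule filterlim_at_top_mono)
  show "filterlim (\<lambda>n. real n / 2) at_top sequentially" by real_asymp
  show "\<forall>\<^sub>F n in sequentially. real n / 2 \<le> u n"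
    using eventually_critical_point by eventually_elim simp
qed

lemma t_at_top: "filterlim t at_top sequentially"
proof (rule filterlim_at_top_mono)
  have "filterlim (\<lambda>n. inverse (r n / real n)) at_top sequentially"
    by (rule filterlim_inverse_at_top[OF r_over_n], use eventually_critical_point in eventually_elim) auto
  then have "filterlim (\<lambda>n. 1/2 * inverse (r n / real n)) at_top sequentially"
    by (rule filterlim_tendsto_pos_mult_at_top[OF tendsto_const, rotated]) simp
  then show "filterlim (\<lambda>n. - 1 + 1/2 * inverse (r n / real n)) at_top sequentially"
    by (rule filterlim_tendsto_add_at_top[OF tendsto_const])
  show "\<forall>\<^sub>F n in sequentially. - 1 + 1/2 * inverse (r n / real n) \<le> t n"
    using eventually_critical_point
  proof eventually_elim
    case (elim n)
    then have "u n \<le> r n * (t n + 1)"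
      using critical_point.u_le_r_mult by (simp add: u_def)
    then show ?case
      using elim by (simp add: field_simps)
  qed
qed

lemma u_over_t_plus_u: "(\<lambda>n. u n / (t n + u n)) \<longlonglongrightarrow> 1"
proof -
  have "(\<lambda>n. 1 - r n / real n - s n / real n - t n / real n) \<longlonglongrightarrow> 1 - 0 - 0 - 0"
    "(\<lambda>n. 1 - r n / real n - s n / real n) \<longlonglongrightarrow> 1 - 0 - 0"
    by (intro tendsto_intros r_over_n s_over_n t_over_n)+
  then have "(\<lambda>n. (1 - r n / real n - s n / real n - t n / real n) / (1 - r n / real n - s n / real n))
      \<longlonglongrightarrow> 1 / 1"
    by (intro tendsto_divide) auto
  moreover have "\<forall>\<^sub>F n in sequentially. (1 - r n / real n - s n / real n - t n / real n)
      / (1 - r n / real n - s n / real n) = u n / (t n + u n)"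
    using eventually_critical_point
  proof eventually_elim
    case (elim n)
    then have "1 - r n / real n - s n / real n - t n / real n = u n / real n"
      "1 - r n / real n - s n / real n = (t n + u n) / real n"
      by (simp_all add: u_def field_simps)
    then show ?case
      using elim by simp
  qed
  ultimately show ?thesis
    by (simp add: Lim_transform_eventually)
qed

definition quadratic_error :: "real \<Rightarrow> nat \<Rightarrow> real" where
  "quadratic_error K n = 5 * K * ((r n + s n) / (r n * sqrt (real n)))
     + (30 * (K\<^sup>2 * ((1 + r n + s n) / real n)) + 3 * (K\<^sup>2 * (1 / r n + 2 * (K / sqrt (real n)))))"

lemma quadratic_error_tendsto: "quadratic_error K \<longlonglongrightarrow> 0"
proof -
  have inverse: "(\<lambda>n. 1 / r n) \<longlonglongrightarrow> 0" "(\<lambda>n. 1 / (r n / sqrt (real n))) \<longlonglongrightarrow> 0"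
    by (intro tendsto_divide_0[OF tendsto_const] filterlim_at_top_imp_at_infinity
        r_at_top r_over_sqrt_at_top)+
  have inverse_n: "(\<lambda>n. 1 / sqrt (real n)) \<longlonglongrightarrow> 0" "(\<lambda>n. 1 / real n) \<longlonglongrightarrow> 0"
    by real_asymp+
  have "(\<lambda>n. 5 * K * (1 / sqrt (real n) + s n / real n * (1 / (r n / sqrt (real n))))
      + (30 * (K\<^sup>2 * (1 / real n + r n / real n + s n / real n))
         + 3 * (K\<^sup>2 * (1 / r n + 2 * (K * (1 / sqrt (real n)))))))
      \<longlonglongrightarrow> 5 * K * (0 + 0 * 0) + (30 * (K\<^sup>2 * (0 + 0 + 0)) + 3 * (K\<^sup>2 * (0 + 2 * (K * 0))))"
    by (intro tendsto_intros inverse inverse_n r_over_n s_over_n)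
  moreover have "\<forall>\<^sub>F n in sequentially.
      5 * K * (1 / sqrt (real n) + s n / real n * (1 / (r n / sqrt (real n))))
      + (30 * (K\<^sup>2 * (1 / real n + r n / real n + s n / real n))
         + 3 * (K\<^sup>2 * (1 / r n + 2 * (K * (1 / sqrt (real n)))))) = quadratic_error K n"
    using eventually_critical_point
  proof eventually_elim
    case (elim n)
    then have "(r n + s n) / (r n * q) = 1 / q + s n / (q * q) * (1 / (r n / q))" if "q > 0" for q
      using that by (simp add: field_simps)
    from this[of "sqrt (real n)"] show ?case
      using elim by (simp add: quadratic_error_def add_divide_distrib)
  qed
  ultimately show ?thesis
    by (simp add: Lim_transform_eventually)
qed

abbreviation log_summand_pair :: "nat \<Rightarrow> real \<times> real \<Rightarrow> real" where
  "log_summand_pair n \<equiv> \<lambda>(x, y). log_summand (real n) x y"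

abbreviation rescale :: "nat \<Rightarrow> real \<times> real \<Rightarrow> real \<times> real" where
  "rescale n p \<equiv> (r n, s n) + scale_pair (r n / sqrt (real n)) (s n / sqrt (real n)) p"

lemma eventually_quadratic_domain:
  "\<forall>\<^sub>F n in sequentially. 2 \<le> r n \<and> 0 < s n \<and> 4 * (1 + r n + s n) \<le> real n \<and> 2 * K \<le> sqrt (real n)"
proof -
  have "(\<lambda>n. 1 / real n + r n / real n + s n / real n) \<longlonglongrightarrow> 0 + 0 + 0"
    by (intro tendsto_intros r_over_n s_over_n)
  then have "\<forall>\<^sub>F n in sequentially. 1 / real n + r n / real n + s n / real n < 1/4"
    by (intro order_tendstoD) auto
  moreover have "\<forall>\<^sub>F n in sequentially. 2 \<le> r n"
    using r_at_top by (simp add: filterlim_at_top)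
  moreover have "\<forall>\<^sub>F n::nat in sequentially. 2 * K \<le> sqrt (real n)"
    by real_asymp
  ultimately show ?thesis
    using eventually_critical_point by eventually_elim (simp add: field_simps)
qed

lemma eventually_quadratic_approx:
  "\<forall>\<^sub>F n in sequentially. \<forall>p\<in>cball 0 K. rescale n p \<in> summand_domain (real n) \<and>
     \<bar>log_summand_pair n (rescale n p) - log_summand_pair n (r n, s n) + (norm p)\<^sup>2 / 2\<bar>
         \<le> quadratic_error K n"
  using eventually_critical_point eventually_quadratic_domain[of K]
proof eventually_elim
  case (elim n)
  then interpret point: critical_point n "r n" "s n" "t n" by simp
  have r_bounds: "1 \<le> r n" "r n \<le> point.u"
    using elim by (auto simp: u_def)
  have domain: "2 \<le> r n" "0 < s n" "4 * (1 + r n + s n) \<le> real n" "2 * K \<le> sqrt (real n)"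
    using elim by auto
  show ?case
  proof (intro ballI conjI)
    fix p :: "real \<times> real"
    assume "p \<in> cball 0 K"
    moreover obtain x y where p_eq: "p = (x, y)"
      by (cases p)
    ultimately have coords_le: "\<bar>x\<bar> \<le> K" "\<bar>y\<bar> \<le> K"
      using norm_fst_le[of x y] norm_snd_le[of y x] by auto
    have rescale: "rescale n p = (r n + x * r n / sqrt (real n), s n + y * s n / sqrt (real n))"
      and norm: "(norm p)\<^sup>2 = x\<^sup>2 + y\<^sup>2"
      by (simp_all add: p_eq mult.commute norm_prod_def)
    show "rescale n p \<in> summand_domain (real n)"
      unfolding rescale by (rule shifted_in_summand_domain[OF domain coords_le])
    show "\<bar>log_summand_pair n (rescale n p) - log_summand_pair n (r n, s n) + (norm p)\<^sup>2 / 2\<bar>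
        \<le> quadratic_error K n"
      unfolding rescale norm quadratic_error_def prod.case
      using abs_log_summand_quadratic_approx_le[OF domain coords_le]
        point.abs_log_summand_slope_le[OF r_bounds coords_le]
      by linarith
  qed
qed

lemma c_sum_asymp_equiv_summand:
  "c_sum \<sim>[sequentially] (\<lambda>n. 2 * pi * (r n / sqrt (real n) * (s n / sqrt (real n))
     * exp (log_summand (real n) (r n) (s n))))"
proof -
  interpret laplace_lattice log_summand_pair "\<lambda>n. summand_domain (real n)"
    "\<lambda>n. (r n, s n)" "\<lambda>n. r n / sqrt (real n)" "\<lambda>n. s n / sqrt (real n)"
  proof
    show "\<forall>\<^sub>F n in sequentially. concave_on (summand_domain (real n)) (log_summand_pair n)"
      by (intro always_eventually allI concave_on_log_summand)
    show "\<forall>\<^sub>F n in sequentially. bounded (summand_domain (real n))"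
      by (intro always_eventually allI bounded_summand_domain)
    show "filterlim (\<lambda>n. r n / sqrt (real n)) at_top sequentially"
      "filterlim (\<lambda>n. s n / sqrt (real n)) at_top sequentially"
      by (fact r_over_sqrt_at_top s_over_sqrt_at_top)+
    fix K :: real
    show "\<forall>\<^sub>F n in sequentially. \<forall>p\<in>cball 0 K. rescale n p \<in> summand_domain (real n)"
      using eventually_quadratic_approx[of K] by eventually_elim blast
    show "uniform_limit (cball 0 K) (\<lambda>n p. log_summand_pair n (rescale n p) - log_summand_pair n (r n, s n))
        (\<lambda>p. - (norm p)\<^sup>2 / 2) sequentially"
    proof (rule uniform_limitI)
      fix e :: real
      assume "e > 0"
      from order_tendstoD(2)[OF quadratic_error_tendsto[of K] this] eventually_quadratic_approx[of K]
      show "\<forall>\<^sub>F n in sequentially. \<forall>p\<in>cball 0 K.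
          dist (log_summand_pair n (rescale n p) - log_summand_pair n (r n, s n)) (- (norm p)\<^sup>2 / 2) < e"
        by eventually_elim (auto simp: dist_real_def simp del: prod.case mem_cball intro: le_less_trans)
    qed
  qed
  show ?thesis
    using lattice_sum_asymp_equiv by (simp add: c_sum_eq_lattice_sum[abs_def])
qed

lemma mean_error_tendsto: "(\<lambda>n. (t n * r n - u n)\<^sup>2 / ((t n + u n) * r n)) \<longlonglongrightarrow> 0"
proof (rule Lim_null_comparison)
  show "\<forall>\<^sub>F n in sequentially. norm ((t n * r n - u n)\<^sup>2 / ((t n + u n) * r n)) \<le> 2 * (r n / real n)"
    using eventually_critical_point
  proof eventually_elim
    case (elim n)
    then interpret point: critical_point n "r n" "s n" "t n" by simp
    have pos: "0 < r n" "0 < t n" "0 < u n"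
      using point.positive by (auto simp: u_def)
    have "(t n * r n - u n)\<^sup>2 / ((t n + u n) * r n) \<le> (r n)\<^sup>2 / (real n / 2 * r n)"
      using point.abs_mean_error_le elim pos
      by (intro frac_le mult_right_mono) (auto simp: u_def power2_le_iff_abs_le)
    also have "\<dots> = 2 * (r n / real n)"
      using pos by (simp add: power2_eq_square)
    finally show ?case
      using pos by simp
  qed
  show "(\<lambda>n. 2 * (r n / real n)) \<longlonglongrightarrow> 0"
    using tendsto_mult_right_zero[OF r_over_n] by simp
qed

lemma F_term_asymp_equiv_summand:
  "(\<lambda>n. F_term n (r n) (s n) (t n) * sqrt (t n)) \<sim>[sequentially]
     (\<lambda>n. exp (log_summand (real n) (r n) (s n)) / sqrt (2 * pi))"
proof -
  have "(\<lambda>n. binomial_density (t n) (u n) (r n) * sqrt (t n * u n / (t n + u n))) \<longlonglongrightarrow> 1 / sqrt (2 * pi)"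
    using eventually_critical_point
    by (intro binomial_density_tendsto t_at_top u_at_top mean_error_tendsto) (auto elim: eventually_mono)
  moreover have "(\<lambda>n. sqrt (u n / (t n + u n))) \<longlonglongrightarrow> 1"
    using tendsto_real_sqrt[OF u_over_t_plus_u] by simp
  ultimately have "(\<lambda>n. binomial_density (t n) (u n) (r n) * sqrt (t n * u n / (t n + u n))
      / sqrt (u n / (t n + u n))) \<longlonglongrightarrow> 1 / sqrt (2 * pi)"
    using tendsto_divide by fastforce
  then have "(\<lambda>n. binomial_density (t n) (u n) (r n) * sqrt (t n)) \<longlonglongrightarrow> 1 / sqrt (2 * pi)"
  proof (rule Lim_transform_eventually, use eventually_critical_point in eventually_elim)
    case (elim n)
    then show ?case
      by (simp add: real_sqrt_mult flip: times_divide_eq_right)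
  qed
  then have "(\<lambda>n. binomial_density (t n) (u n) (r n) * sqrt (t n)) \<sim>[sequentially] (\<lambda>_. 1 / sqrt (2 * pi))"
    by (intro tendsto_imp_asymp_equiv_const) auto
  from asymp_equiv_mult[OF asymp_equiv_refl this, of "\<lambda>n. exp (log_summand (real n) (r n) (s n))"]
  show ?thesis
  proof (rule asymp_equiv_transfer)
    show "\<forall>\<^sub>F n in sequentially. exp (log_summand (real n) (r n) (s n))
        * (binomial_density (t n) (u n) (r n) * sqrt (t n)) = F_term n (r n) (s n) (t n) * sqrt (t n)"
      using eventually_critical_point
      by eventually_elim (simp add: critical_point.F_term_eq_binomial_density u_def)
  qed simp
qed

theorem c_sum_asymp_equiv:
  "c_sum \<sim>[sequentially]
     (\<lambda>n. F_term n (r n) (s n) (t n) * ((2 * pi) powr (3 / 2) * r n * s n * sqrt (t n) / real n))"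
proof -
  have "(2 * pi) powr (3/2) = (2 * pi) powr (1 + 1/2)" by simp
  also have "\<dots> = 2 * pi * sqrt (2 * pi)"
    by (subst powr_add) (simp add: powr_half_sqrt)
  finally have powr: "(2 * pi) powr (3/2) = 2 * pi * sqrt (2 * pi)" .
  let ?C = "\<lambda>n. (2 * pi) powr (3/2) * r n * s n / real n"
  have "(\<lambda>n. ?C n * (exp (log_summand (real n) (r n) (s n)) / sqrt (2 * pi))) \<sim>[sequentially]
      (\<lambda>n. ?C n * (F_term n (r n) (s n) (t n) * sqrt (t n)))"
    by (intro asymp_equiv_mult asymp_equiv_refl asymp_equiv_symI[OF F_term_asymp_equiv_summand])
  moreover have "?C n * (exp (log_summand (real n) (r n) (s n)) / sqrt (2 * pi)) =
      2 * pi * (r n / sqrt (real n) * (s n / sqrt (real n)) * exp (log_summand (real n) (r n) (s n)))" for n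
    unfolding powr by simp
  ultimately show ?thesis
    using asymp_equiv_trans[OF c_sum_asymp_equiv_summand] by (simp add: mult_ac)
qed

end

theorem theorem32:
  "(\<forall>\<^sub>F n in sequentially. \<exists>!(r, s, t). critical n r s t) \<and>
   (\<forall>r s t :: nat \<Rightarrow> real.
      (\<forall>\<^sub>F n in sequentially. critical n (r n) (s n) (t n)) \<longrightarrow>
      c_sum \<sim>[sequentially]
        (\<lambda>n. F_term n (r n) (s n) (t n) * ((2 * pi) powr (3 / 2) * r n * s n * sqrt (t n) / real n)))"
proof (intro conjI allI impI)
  show "\<forall>\<^sub>F n in sequentially. \<exists>!(r, s, t). critical n r s t"
    by (fact eventually_ex1_critical)
next
  fix r s t :: "nat \<Rightarrow> real"
  assume "\<forall>\<^sub>F n in sequentially. critical n (r n) (s n) (t n)"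
  then interpret critical_sequence r s t by unfold_locales
  show "c_sum \<sim>[sequentially]
      (\<lambda>n. F_term n (r n) (s n) (t n) * ((2 * pi) powr (3 / 2) * r n * s n * sqrt (t n) / real n))"
    by (fact c_sum_asymp_equiv)
qed

end
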